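(* Let $\beta>0$ and let $x(0)=(x_j(0))_{j\in\mathbb{Z}}\in\ell^\infty_+$ be initial data with $x_j(0)>0$ for all $j\in\mathbb{Z}$ such that there are a constant $d>0$, an integer $L>0$ and $k_0\in\{0,1,\dots,L-1\}$ with $$\frac1L\sum_{j=k_0+kL}^{k_0+(k+1)L-1}x_j(0)\ \ge\ d\qquad\text{for all }k\in\mathbb{Z}.$$ Then there exists a solution $x\colon[0,\infty)\to\ell^\infty_+$ of $\dot x_j=\Delta_\sigma x_j^{-\beta}$, $j\in\mathbb{Z}$, with initial data $x(0)$ which has the following properties (here $\tau_j$ denotes the vanishing time of $x_j$): (1) for any $T>0$ there is a constant $C=C(\beta,d,L,T)$ such that $x_j(t)\le x_j(0)+C$ for all $t\in[0,T]$ and all $j\in\mathbb{Z}$; (2) for any $T>0$ each $x_j$ is Hölder continuous in $[0,T]$ with exponent $1/(\beta+1)$ and $\|x_j\|_{C^{0,1/(\beta+1)}([0,T])}\le C=C(\beta,d,L,T)$; (3) if $\tau_j<\infty$, then $x_j(t)\le C(\tau_j-t)^{1/(\beta+1)}$ for all $t\in[0,\tau_j]$, where $C=C(\beta)$; (4) for any $T>0$ there is a constant $K=K(\beta,d,L,T)>0$ such that $\tau_j<T$ implies $x_j(t)\ge K(\tau_j-t)^{1/(\beta+1)}$ for all $t\in[0,\tau_j]$ and for any $j\in\mathbb{Z}$.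
   Context: Let $\ell^\infty_+$ be the set of sequences $x=(x_j)_{j\in\mathbb{Z}}$ with $0\le x_j\le C$ for all $j$ and some constant $C$ depending on $x$. Convention: $0^{-\beta}=0$. For $x\in\ell^\infty_+$ and $j\in\mathbb{Z}$ put $\sigma_-(j,x)=\sup\{k<j:x_k>0\}$, $\sigma_+(j,x)=\inf\{k>j:x_k>0\}$, with $\sup\emptyset=-\infty$, $\inf\emptyset=+\infty$, $x_{\pm\infty}=0$, and $$\Delta_\sigma x_j^{-\beta}=\big(x_{\sigma_-(j,x)}^{-\beta}-2x_j^{-\beta}+x_{\sigma_+(j,x)}^{-\beta}\big)\,\chi_{\{x_j>0\}}.$$ For $T\in(0,\infty]$, a solution on $[0,T)$ of $\dot x_j=\Delta_\sigma x_j^{-\beta}$ ($j\in\mathbb{Z}$) with initial data $x(0)$ is a map $x=(x_j)\colon[0,T)\to\ell^\infty_+$ such that each $x_j$ is continuous on $[0,T)$; each $x_j^{-\beta}\chi_{\{x_j>0\}}$ is locally integrable in $[0,T)$; and $x_j(t_2)-x_j(t_1)=\int_{t_1}^{t_2}\Delta_\sigma x_j(s)^{-\beta}\,ds$ for all $j$ and $0\le t_1<t_2<T$. Each particle of a solution has a unique vanishing time $\tau_j\in[0,T)\cup\{\infty\}$: $x_j(t)>0$ for $t<\tau_j$, $x_j(t)=0$ for $t\ge\tau_j$, and $\tau_j=\infty$ iff $x_j>0$ on all of $[0,T)$. For $0<\alpha\le 1$, $\|\cdot\|_{C^{0,\alpha}([0,T])}$ denotes the usual norm of the Hölder space $C^{0,\alpha}([0,T])$,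 i.e. $\|f\|_{C^{0,\alpha}([0,T])}=\sup_{0\le t\le T}|f(t)|+\sup_{0\le t_1<t_2\le T}\frac{|f(t_2)-f(t_1)|}{|t_2-t_1|^{\alpha}}$.
   Formalization: In (2) the bound proved is ‖x_j‖ ≤ x_j(0)+C(β,d,L,T) instead of ≤ C(β,d,L,T): the latter fails for constant data x_j(0)=M with M large, as the norm includes sup|x_j| ≥ M. The Hölder seminorm is still bounded by C(β,d,L,T). *)

theory Defs
  imports "HOL-Analysis.Analysis"
begin

definition linf_plus :: "(int \<Rightarrow> real) set" where
  "linf_plus = {x. \<exists>C. \<forall>j. 0 \<le> x j \<and> x j \<le> C}"

(* Taken in ereal, Sup {} is -\<infinity> and Inf {} is \<infinity>. *)
definition sigma_minus :: "int \<Rightarrow> (int \<Rightarrow> real) \<Rightarrow> ereal" where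
  "sigma_minus j x = Sup {ereal (real_of_int k) | k. k < j \<and> x k > 0}"

definition sigma_plus :: "int \<Rightarrow> (int \<Rightarrow> real) \<Rightarrow> ereal" where
  "sigma_plus j x = Inf {ereal (real_of_int k) | k. k > j \<and> x k > 0}"

(* x evaluated at an extended index. The finite values of sigma_minus and sigma_plus are
   integers, so the floor only converts their type. *)
definition ext_val :: "(int \<Rightarrow> real) \<Rightarrow> ereal \<Rightarrow> real" where
  "ext_val x e = (if \<bar>e\<bar> = \<infinity> then 0 else x \<lfloor>real_of_ereal e\<rfloor>)"

(* In the library 0 powr a = 0 for every a, which is exactly the convention that zero raised
   to the power - \<beta> is zero. *)
definition Delta_sigma :: "real \<Rightarrow> (int \<Rightarrow> real) \<Rightarrow> int \<Rightarrow> real" where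
  "Delta_sigma \<beta> x j =
     (ext_val x (sigma_minus j x) powr (- \<beta>)
        - 2 * x j powr (- \<beta>)
        + ext_val x (sigma_plus j x) powr (- \<beta>)) * of_bool (x j > 0)"

(* x t j is the value of particle j at time t; values of x outside [0,T) are irrelevant.
   Integrability of the right-hand side is demanded explicitly because the library's integral
   of a non-integrable function is 0. *)
definition is_solution ::
  "real \<Rightarrow> ereal \<Rightarrow> (int \<Rightarrow> real) \<Rightarrow> (real \<Rightarrow> int \<Rightarrow> real) \<Rightarrow> bool" where
  "is_solution \<beta> T x0 x \<longleftrightarrow>
     (\<forall>t. 0 \<le> t \<and> ereal t < T \<longrightarrow> x t \<in> linf_plus) \<and>
     (\<forall>j. continuous_on {t. 0 \<le> t \<and> ereal t < T} (\<lambda>t. x t j)) \<and>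
     (\<forall>j t. 0 \<le> t \<and> ereal t < T \<longrightarrow>
        set_integrable lborel {0..t} (\<lambda>s. x s j powr (- \<beta>) * of_bool (x s j > 0))) \<and>
     (\<forall>j t1 t2. 0 \<le> t1 \<and> t1 < t2 \<and> ereal t2 < T \<longrightarrow>
        set_integrable lborel {t1..t2} (\<lambda>s. Delta_sigma \<beta> (x s) j) \<and>
        x t2 j - x t1 j = (LINT s:{t1..t2}|lborel. Delta_sigma \<beta> (x s) j)) \<and>
     x 0 = x0"

definition is_vanishing_time ::
  "ereal \<Rightarrow> (real \<Rightarrow> int \<Rightarrow> real) \<Rightarrow> int \<Rightarrow> ereal \<Rightarrow> bool" where
  "is_vanishing_time T x j \<tau> \<longleftrightarrow>
     0 \<le> \<tau> \<and> (\<tau> < T \<or> \<tau> = \<infinity>) \<and>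
     (\<forall>t. 0 \<le> t \<and> ereal t < T \<longrightarrow>
        (ereal t < \<tau> \<longrightarrow> x t j > 0) \<and> (\<tau> \<le> ereal t \<longrightarrow> x t j = 0)) \<and>
     (\<tau> = \<infinity> \<longleftrightarrow> (\<forall>t. 0 \<le> t \<and> ereal t < T \<longrightarrow> x t j > 0))"

definition hoelder_continuous_on :: "real \<Rightarrow> real set \<Rightarrow> (real \<Rightarrow> real) \<Rightarrow> bool" where
  "hoelder_continuous_on \<alpha> S f \<longleftrightarrow>
     (\<exists>H. \<forall>t1\<in>S. \<forall>t2\<in>S. \<bar>f t2 - f t1\<bar> \<le> H * \<bar>t2 - t1\<bar> powr \<alpha>)"

(* The norm takes values in ereal, so that it is infinite, rather than arbitrary, for
   functions outside the Hoelder space. *)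
definition hoelder_norm :: "real \<Rightarrow> real \<Rightarrow> (real \<Rightarrow> real) \<Rightarrow> ereal" where
  "hoelder_norm \<alpha> T f =
     (SUP t\<in>{0..T}. ereal \<bar>f t\<bar>) +
     (SUP (t1, t2)\<in>{(t1, t2). 0 \<le> t1 \<and> t1 < t2 \<and> t2 \<le> T}.
        ereal (\<bar>f t2 - f t1\<bar> / \<bar>t2 - t1\<bar> powr \<alpha>))"

end

theory Submission
  imports Defs "HOL-Library.Diagonal_Subsequence"
begin

text \<open>The right-hand side at \<open>j\<close> is a difference of one-sided fluxes, so the mass of a block of
  particles changes only through its two ends. A particle of size \<open>D\<close> needs a time of order
  \<open>D\<^sup>\<beta>\<^sup>+\<^sup>1\<close> to shrink to half its size, hence blocks that end in large particles lose little mass,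
  and the density lower bound survives up to time \<open>T\<close> on blocks of a larger length \<open>N\<close>. Consequently a
  particle of small size \<open>e\<close> lies in a cluster of boundedly many small particles between much larger
  ones; such a cluster loses mass through its ends and dies within a time of order \<open>e\<^sup>\<beta>\<^sup>+\<^sup>1\<close>.
  This is the lower bound (4); integrating the resulting bound on \<open>x\<^sub>k\<^sup>-\<^sup>\<beta>\<close> over the at most \<open>2 N + 1\<close>
  particles that can be neighbours of \<open>j\<close> gives the Hoelder bounds (1) and (2).
  A solution is obtained as a limit of systems with finitely many particles and the nonlinearity
  \<open>(z + \<epsilon>) powr (- \<beta>)\<close>, which obey the same estimates uniformly.\<close>

section \<open>Nearest positive particles\<close>

text \<open>The main obstacle is that the right-hand side is not continuous in the configuration:
  when a particle dies, its reciprocal power blows up and the neighbours of \<open>j\<close> jump.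
  Convergence of all sizes therefore does not give convergence of the right-hand side. The lower
  bound (4), being uniform in the approximation, removes the obstacle: a particle whose limit is
  zero at time \<open>t\<close> has died in almost all approximations before any later time. Away
  from the vanishing times of the finitely many sites that can interact with \<open>j\<close>, the
  set of living sites thus stabilises, and the limit is differentiable with the right derivative.
  Each site contributes at most one exceptional time, and the fundamental theorem of calculus
  tolerates finitely many. Both simplifications of the approximate systems are needed for their
  existence proof: finiteness yields a first vanishing time and finitely many restarts, and
  \<epsilon> keeps the equation Lipschitz up to a vanishing time. The price of truncation is that
  every estimate is stated on a range \<open>lo..hi\<close> of sites with margins at its
  ends.\<close>

definition lft :: "int set \<Rightarrow> (int \<Rightarrow> real) \<Rightarrow> int \<Rightarrow> real" where
  "lft A v j = (if \<exists>k\<in>A. k \<le> j then v (GREATEST k. k \<in> A \<and> k \<le> j) else 0)"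

definition rgt :: "int set \<Rightarrow> (int \<Rightarrow> real) \<Rightarrow> int \<Rightarrow> real" where
  "rgt A v j = (if \<exists>k\<in>A. j \<le> k then v (LEAST k. k \<in> A \<and> j \<le> k) else 0)"

text \<open>\<open>lft\<close> and \<open>rgt\<close> include \<open>j\<close> itself in the search,
  so crossing a dead site changes neither. Hence both parts of \<open>lap\<close> are differences of
  consecutive values, while on \<open>A\<close> they still add up to the second difference over
  nearest neighbours.\<close>

definition lap :: "int set \<Rightarrow> (int \<Rightarrow> real) \<Rightarrow> int \<Rightarrow> real" where
  "lap A v j = lft A v (j - 1) - lft A v j + (rgt A v (j + 1) - rgt A v j)"

lemma nearest_below:
  fixes A :: "int set"
  assumes "p \<in> A" "p \<le> j"
  obtains k where "k \<in> A" "p \<le> k" "k \<le> j" "\<forall>i\<in>A. i \<le> j \<longrightarrow> i \<le> k"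
proof -
  let ?B = "A \<inter> {p..j}"
  have "finite ?B" "p \<in> ?B" using assms by auto
  then have "Max ?B \<in> ?B" "\<forall>i\<in>?B. i \<le> Max ?B"
    by (metis Max_in empty_iff, metis Max_ge)
  then show thesis using that[of "Max ?B"] assms
    by (metis IntD1 IntD2 IntI atLeastAtMost_iff linear order_trans)
qed

lemma nearest_above:
  fixes A :: "int set"
  assumes "q \<in> A" "j \<le> q"
  obtains k where "k \<in> A" "j \<le> k" "k \<le> q" "\<forall>i\<in>A. j \<le> i \<longrightarrow> k \<le> i"
proof -
  let ?B = "A \<inter> {j..q}"
  have "finite ?B" "q \<in> ?B" using assms by auto
  then have "Min ?B \<in> ?B" "\<forall>i\<in>?B. Min ?B \<le> i"
    by (metis Min_in empty_iff, metis Min_le)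
  then show thesis using that[of "Min ?B"] assms
    by (metis IntD1 IntD2 IntI atLeastAtMost_iff linear order_trans)
qed

lemma lft_eqI:
  assumes "k \<in> A" "k \<le> j" "\<forall>i\<in>A. i \<le> j \<longrightarrow> i \<le> k"
  shows "lft A v j = v k"
proof -
  have "(GREATEST k. k \<in> A \<and> k \<le> j) = k" using assms by (intro Greatest_equality) auto
  then show ?thesis using assms by (auto simp: lft_def)
qed

lemma rgt_eqI:
  assumes "k \<in> A" "j \<le> k" "\<forall>i\<in>A. j \<le> i \<longrightarrow> k \<le> i"
  shows "rgt A v j = v k"
proof -
  have "(LEAST k. k \<in> A \<and> j \<le> k) = k" using assms by (intro Least_equality) auto
  then show ?thesis using assms by (auto simp: rgt_def)
qed

lemma lft_cases:
  assumes "p \<in> A" "p \<le> j"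
  obtains k where "k \<in> A" "p \<le> k" "k \<le> j" "\<And>v. lft A v j = v k"
proof -
  obtain k where k: "k \<in> A" "p \<le> k" "k \<le> j" "\<forall>i\<in>A. i \<le> j \<longrightarrow> i \<le> k"
    using nearest_below[OF assms] by blast
  show thesis by (rule that[OF k(1-3)], rule lft_eqI) (use k in auto)
qed

lemma rgt_cases:
  assumes "q \<in> A" "j \<le> q"
  obtains k where "k \<in> A" "j \<le> k" "k \<le> q" "\<And>v. rgt A v j = v k"
proof -
  obtain k where k: "k \<in> A" "j \<le> k" "k \<le> q" "\<forall>i\<in>A. j \<le> i \<longrightarrow> k \<le> i"
    using nearest_above[OF assms] by blast
  show thesis by (rule that[OF k(1-3)], rule rgt_eqI) (use k in auto)
qed

lemma lft_mem [simp]: "j \<in> A \<Longrightarrow> lft A v j = v j"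
  by (rule lft_eqI) auto

lemma rgt_mem [simp]: "j \<in> A \<Longrightarrow> rgt A v j = v j"
  by (rule rgt_eqI) auto

lemma lft_notmem: "j \<notin> A \<Longrightarrow> lft A v j = lft A v (j - 1)"
proof -
  assume "j \<notin> A"
  then have "k \<in> A \<and> k \<le> j \<longleftrightarrow> k \<in> A \<and> k \<le> j - 1" for k
    by (cases "k = j") auto
  then show ?thesis unfolding lft_def Bex_def by presburger
qed

lemma rgt_notmem: "j \<notin> A \<Longrightarrow> rgt A v j = rgt A v (j + 1)"
proof -
  assume "j \<notin> A"
  then have "k \<in> A \<and> j \<le> k \<longleftrightarrow> k \<in> A \<and> j + 1 \<le> k" for k
    by (cases "k = j") auto
  then show ?thesis unfolding rgt_def Bex_def by presburger
qed

lemma lap_mem: "j \<in> A \<Longrightarrow> lap A v j = lft A v (j - 1) - 2 * v j + rgt A v (j + 1)"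
  by (simp add: lap_def)

lemma lap_notmem: "j \<notin> A \<Longrightarrow> lap A v j = 0"
  by (simp add: lap_def lft_notmem[of j] rgt_notmem[of j])

text \<open>The nearest site depends on \<open>A\<close> and \<open>j\<close> only, so one
  \<open>k\<close> serves every \<open>v\<close>. Nonnegativity, Lipschitz bounds and limits carry
  over to \<open>lft A v j\<close> by inspecting a single value.\<close>

lemma lft_eq_or: "(\<forall>v. lft A v j = 0) \<or> (\<exists>k\<in>A. \<forall>v. lft A v j = v k)"
proof (cases "\<exists>k\<in>A. k \<le> j")
  case True
  then show ?thesis by (metis lft_cases)
next
  case False
  then show ?thesis by (auto simp: lft_def)
qed

lemma rgt_eq_or: "(\<forall>v. rgt A v j = 0) \<or> (\<exists>k\<in>A. \<forall>v. rgt A v j = v k)"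
proof (cases "\<exists>k\<in>A. j \<le> k")
  case True
  then show ?thesis by (metis rgt_cases)
next
  case False
  then show ?thesis by (auto simp: rgt_def)
qed

lemma lft_nonneg: "(\<And>k. 0 \<le> v k) \<Longrightarrow> 0 \<le> lft A v j"
  using lft_eq_or[of A j] by auto

lemma rgt_nonneg: "(\<And>k. 0 \<le> v k) \<Longrightarrow> 0 \<le> rgt A v j"
  using rgt_eq_or[of A j] by auto

text \<open>A dead site contributes 0, so block sums telescope although the neighbours jump over
  dead sites.\<close>
lemma sum_lap:
  assumes "a \<le> b + 1"
  shows "(\<Sum>j=a..b. lap A v j) = lft A v (a - 1) - lft A v b + (rgt A v (b + 1) - rgt A v a)"
proof -
  have "a - 1 \<le> b" using assms by simp
  then show ?thesis
  proof (induction b rule: int_ge_induct)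
    case base
    then show ?case by simp
  next
    case (step i)
    have "{a..i+1} = insert (i+1) {a..i}" using step by auto
    then show ?case using step by (simp add: lap_def)
  qed
qed

text \<open>The search to the left stops at \<open>p\<close> at the latest. This locality reduces
  convergence of the right-hand side to finitely many sites.\<close>

lemma lft_cong:
  assumes "p \<in> A" "p \<le> j" "\<And>k. p \<le> k \<Longrightarrow> k \<le> j \<Longrightarrow> k \<in> A \<longleftrightarrow> k \<in> B"
    "\<And>k. p \<le> k \<Longrightarrow> k \<le> j \<Longrightarrow> k \<in> A \<Longrightarrow> v k = w k"
  shows "lft A v j = lft B w j"
proof -
  obtain k where k: "k \<in> A" "p \<le> k" "k \<le> j" "\<forall>i\<in>A. i \<le> j \<longrightarrow> i \<le> k"
    using nearest_below[OF assms(1,2)] by metis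
  have "lft A v j = v k" using k lft_eqI by metis
  moreover have "lft B w j = w k"
  proof (rule lft_eqI)
    show "k \<in> B" using k assms by auto
    show "\<forall>i\<in>B. i \<le> j \<longrightarrow> i \<le> k" using k assms(3) by (metis linorder_not_le order_trans less_imp_le)
  qed (use k in auto)
  ultimately show ?thesis using k assms(4) by auto
qed

lemma rgt_cong:
  assumes "q \<in> A" "j \<le> q" "\<And>k. j \<le> k \<Longrightarrow> k \<le> q \<Longrightarrow> k \<in> A \<longleftrightarrow> k \<in> B"
    "\<And>k. j \<le> k \<Longrightarrow> k \<le> q \<Longrightarrow> k \<in> A \<Longrightarrow> v k = w k"
  shows "rgt A v j = rgt B w j"
proof -
  obtain k where k: "k \<in> A" "j \<le> k" "k \<le> q" "\<forall>i\<in>A. j \<le> i \<longrightarrow> k \<le> i"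
    using nearest_above[OF assms(1,2)] by metis
  have "rgt A v j = v k" using k rgt_eqI by metis
  moreover have "rgt B w j = w k"
  proof (rule rgt_eqI)
    show "k \<in> B" using k assms by auto
    show "\<forall>i\<in>B. j \<le> i \<longrightarrow> k \<le> i" using k assms(3) by (metis linorder_not_le order_trans less_imp_le)
  qed (use k in auto)
  ultimately show ?thesis using k assms(4) by auto
qed

text \<open>The shift by \<epsilon> enters only the nonlinearity. Positivity of \<open>z\<close>
  still decides which sites are neighbours, so dead sites of the regularised system are skipped as
  in the original one.\<close>

definition lapg :: "real \<Rightarrow> real \<Rightarrow> (int \<Rightarrow> real) \<Rightarrow> int \<Rightarrow> real" where
  "lapg \<beta> \<epsilon> z = lap {k. 0 < z k} (\<lambda>k. (z k + \<epsilon>) powr (- \<beta>))"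

section \<open>The operator \<open>Delta_sigma\<close> as the case without regularisation\<close>

lemma ext_val_sigma_minus:
  "ext_val z (sigma_minus j z) powr (- \<beta>) = lft {k. 0 < z k} (\<lambda>k. z k powr (- \<beta>)) (j - 1)"
proof (cases "\<exists>k<j. 0 < z k")
  case True
  then obtain p where "p \<in> {k. 0 < z k}" "p \<le> j - 1" by auto
  then obtain k where k: "k \<in> {k. 0 < z k}" "k \<le> j - 1" "\<forall>i\<in>{k. 0 < z k}. i \<le> j - 1 \<longrightarrow> i \<le> k"
    using nearest_below by metis
  have "sigma_minus j z = ereal (real_of_int k)"
    unfolding sigma_minus_def using k by (intro Sup_eqI) auto
  then have "ext_val z (sigma_minus j z) = z k" by (simp add: ext_val_def)
  then show ?thesis using lft_eqI[OF k] by simp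
next
  case False
  then have "{ereal (real_of_int k) | k. k < j \<and> z k > 0} = {}" by auto
  then have "sigma_minus j z = -\<infinity>" unfolding sigma_minus_def by (metis Sup_empty bot_ereal_def)
  then show ?thesis using False by (auto simp: ext_val_def lft_def)
qed

lemma ext_val_sigma_plus:
  "ext_val z (sigma_plus j z) powr (- \<beta>) = rgt {k. 0 < z k} (\<lambda>k. z k powr (- \<beta>)) (j + 1)"
proof (cases "\<exists>k>j. 0 < z k")
  case True
  then obtain q where "q \<in> {k. 0 < z k}" "j + 1 \<le> q" by auto
  then obtain k where k: "k \<in> {k. 0 < z k}" "j + 1 \<le> k" "\<forall>i\<in>{k. 0 < z k}. j + 1 \<le> i \<longrightarrow> k \<le> i"
    using nearest_above by metis
  have "sigma_plus j z = ereal (real_of_int k)"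
    unfolding sigma_plus_def using k by (intro Inf_eqI) auto
  then have "ext_val z (sigma_plus j z) = z k" by (simp add: ext_val_def)
  then show ?thesis using rgt_eqI[OF k] by simp
next
  case False
  then have "{ereal (real_of_int k) | k. k > j \<and> z k > 0} = {}" by auto
  then have "sigma_plus j z = \<infinity>" unfolding sigma_plus_def by (metis Inf_empty top_ereal_def)
  then show ?thesis using False by (auto simp: ext_val_def rgt_def)
qed

lemma Delta_sigma_eq: "Delta_sigma \<beta> z j = lapg \<beta> 0 z j"
proof (cases "0 < z j")
  case True
  then show ?thesis
    by (simp add: Delta_sigma_def ext_val_sigma_minus ext_val_sigma_plus lapg_def lap_mem)
next
  case False
  then show ?thesis by (simp add: Delta_sigma_def lapg_def lap_notmem)
qed

text \<open>Neighbours contribute nonnegative terms, so a particle loses at most its own flux to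
  both sides; a large particle shrinks slowly whatever surrounds it.\<close>

lemma lapg_ge: "- 2 * (z j + \<epsilon>) powr (- \<beta>) \<le> lapg \<beta> \<epsilon> z j"
proof (cases "0 < z j")
  case True
  then show ?thesis
    using lft_nonneg[of "\<lambda>k. (z k + \<epsilon>) powr (- \<beta>)" "{k. 0 < z k}" "j - 1"]
      rgt_nonneg[of "\<lambda>k. (z k + \<epsilon>) powr (- \<beta>)" "{k. 0 < z k}" "j + 1"]
    by (simp add: lapg_def lap_mem)
qed (simp add: lapg_def lap_notmem)

section \<open>Persistence of density\<close>

text \<open>A continuation argument: the rate bound is known only while \<open>F\<close> stays above
  the barrier \<open>a\<close>, and it is what keeps \<open>F\<close> there. At the first time with
  \<open>F \<le> a\<close> the integrated bound is valid and contradicts the strict inequality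
  \<open>above\<close>. Applied to the negative of a mass, the lemma yields decay.\<close>

lemma barrier:
  fixes F f :: "real \<Rightarrow> real"
  assumes cont: "continuous_on {t0..t1} F"
    and int: "\<And>v. t0 \<le> v \<Longrightarrow> v \<le> t1 \<Longrightarrow> (f has_integral (F v - F t0)) {t0..v}"
    and rate: "\<And>s. t0 \<le> s \<Longrightarrow> s \<le> t1 \<Longrightarrow> a \<le> F s \<Longrightarrow> - c \<le> f s"
    and above: "\<And>s. t0 \<le> s \<Longrightarrow> s \<le> t1 \<Longrightarrow> a < F t0 - c * (s - t0)"
    and t: "t0 \<le> t" "t \<le> t1"
  shows "a \<le> F t" "F t0 - c * (t - t0) \<le> F t"
proof -
  have le: "F t0 - c * (v - t0) \<le> F v"
    if v: "t0 \<le> v" "v \<le> t1" and *: "\<And>s. t0 \<le> s \<Longrightarrow> s < v \<Longrightarrow> a \<le> F s" for v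
  proof -
    \<comment> \<open>\<open>a \<le> F v\<close> is not assumed at the end point \<open>v\<close>,
      so the integrand is altered there.\<close>
    let ?f = "\<lambda>s. if s = v then - c else f s"
    have int': "(?f has_integral (F v - F t0)) {t0..v}"
      by (rule has_integral_spike_finite[OF _ _ int[OF v], of "{v}"]) auto
    have "((\<lambda>s. - c) has_integral (- c * (v - t0))) {t0..v}"
      using has_integral_const_real[of "-c" t0 v] v by (simp add: mult.commute)
    then have "- c * (v - t0) \<le> F v - F t0"
      by (rule has_integral_le[OF _ int']) (use rate * v in auto)
    then show ?thesis by simp
  qed
  have ge: "a \<le> F s" if s: "t0 \<le> s" "s \<le> t1" for s
  proof (rule ccontr)
    assume "\<not> a \<le> F s"
    define B where "B = {t0..t1} \<inter> F -` {..a}"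
    have "closed B" unfolding B_def by (intro continuous_closed_preimage cont) auto
    have ne: "s \<in> B" using s \<open>\<not> a \<le> F s\<close> by (auto simp: B_def)
    have bd: "bdd_below B" by (auto simp: B_def bdd_below_def)
    define m where "m = Inf B"
    have mB: "m \<in> B" unfolding m_def using closed_contains_Inf[OF _ bd \<open>closed B\<close>] ne by auto
    have "a \<le> F u" if "t0 \<le> u" "u < m" for u
    proof (rule ccontr)
      assume "\<not> a \<le> F u"
      then have "u \<in> B" using that mB by (auto simp: B_def)
      then show False using cInf_lower[OF _ bd, of u] that by (simp add: m_def)
    qed
    then have "F t0 - c * (m - t0) \<le> F m" using le[of m] mB by (auto simp: B_def)
    then show False using above[of m] mB by (auto simp: B_def)
  qed
  then show "a \<le> F t" "F t0 - c * (t - t0) \<le> F t" using le[of t] t by auto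
qed

text \<open>Only windows inside \<open>lo..hi\<close> count because truncated data are dense only
  there. Windows may start at any site, so that a longer window can be cut into shorter ones
  wherever it lies.\<close>

definition dense_windows :: "int \<Rightarrow> int \<Rightarrow> int \<Rightarrow> real \<Rightarrow> (int \<Rightarrow> real) \<Rightarrow> bool" where
  "dense_windows lo hi M D z \<longleftrightarrow>
     (\<forall>a. lo \<le> a \<and> a + M \<le> hi + 1 \<longrightarrow> of_int M * D \<le> (\<Sum>j=a..a+M-1. z j))"

definition anchored :: "int \<Rightarrow> int \<Rightarrow> int \<Rightarrow> real \<Rightarrow> (int \<Rightarrow> real) \<Rightarrow> bool" where
  "anchored lo hi N D z \<longleftrightarrow> (\<forall>a. lo \<le> a \<and> a + N \<le> hi + 1 \<longrightarrow> (\<exists>p\<in>{a..a+N-1}. D \<le> z p))"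

lemma dense_windows_anchored:
  assumes "dense_windows lo hi M D z" "0 < M"
  shows "anchored lo hi M D z"
  unfolding anchored_def
proof (intro allI impI, rule ccontr)
  fix a assume a: "lo \<le> a \<and> a + M \<le> hi + 1" and "\<not> (\<exists>p\<in>{a..a+M-1}. D \<le> z p)"
  then have "(\<Sum>j=a..a+M-1. z j) < (\<Sum>j=a..a+M-1. D)"
    using assms(2) by (intro sum_strict_mono) (auto simp: not_le)
  then show False using assms a by (auto simp: dense_windows_def)
qed

lemma anchored_mono:
  assumes "anchored lo hi N D z" "N \<le> N'" "D' \<le> D"
  shows "anchored lo hi N' D' z"
  unfolding anchored_def
proof (intro allI impI)
  fix a assume "lo \<le> a \<and> a + N' \<le> hi + 1"
  then obtain p where "p \<in> {a..a+N-1}" "D \<le> z p" using assms by (force simp: anchored_def)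
  then show "\<exists>p\<in>{a..a+N'-1}. D' \<le> z p" using assms by (intro bexI[of _ p]) auto
qed

lemma dense_windows_multiple:
  assumes "dense_windows lo hi M D z" "0 < M" "lo \<le> a" "a + int r * M \<le> hi + 1"
  shows "real r * of_int M * D \<le> (\<Sum>j=a..a+int r*M-1. z j)"
  using assms(4)
proof (induction r)
  case (Suc r)
  have M: "0 \<le> int r * M" using assms by simp
  have "{a..a + c + M - 1} = {a..a + c - 1} \<union> {a + c..a + c + M - 1}" if "0 \<le> c" for c
    using assms(2) that by auto
  from this[OF M]
  have split: "{a..a + int (Suc r) * M - 1} = {a..a + int r * M - 1} \<union> {a + int r * M..a + int r * M + M - 1}"
    by (simp add: algebra_simps)
  have "of_int M * D \<le> (\<Sum>j=a + int r * M..a + int r * M + M - 1. z j)"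
    using assms(1)[unfolded dense_windows_def, rule_format, of "a + int r * M"] assms(3) Suc.prems M
    by (simp add: distrib_right add.assoc)
  moreover have "real r * of_int M * D \<le> (\<Sum>j=a..a+int r*M-1. z j)"
    using Suc assms(2) by (auto simp: algebra_simps)
  moreover have "(\<Sum>j=a..a + int (Suc r) * M - 1. z j) =
    (\<Sum>j=a..a+int r*M-1. z j) + (\<Sum>j=a + int r * M..a + int r * M + M - 1. z j)"
    unfolding split by (rule sum.union_disjoint) auto
  ultimately show ?case by (simp add: algebra_simps)
qed simp

text \<open>The solution concept for the regularised nonlinearity \<open>(z + \<epsilon>) powr (- \<beta>)\<close>; the original
  problem is the case \<open>\<epsilon> = 0\<close>. For \<open>\<epsilon> > 0\<close> the nonlinearity is Lipschitz on the half line, and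
  the estimates below do not depend on \<open>\<epsilon>\<close>.\<close>
locale coarsening =
  fixes \<beta> \<epsilon> :: real and x :: "real \<Rightarrow> int \<Rightarrow> real"
  assumes beta: "0 < \<beta>" and eps: "0 \<le> \<epsilon>"
    and nonneg: "0 \<le> t \<Longrightarrow> 0 \<le> x t j"
    and dead: "0 \<le> s \<Longrightarrow> s \<le> t \<Longrightarrow> x s j = 0 \<Longrightarrow> x t j = 0"
    and cont: "continuous_on {0..} (\<lambda>t. x t j)"
    and eqn: "0 \<le> t1 \<Longrightarrow> t1 \<le> t2 \<Longrightarrow>
      ((\<lambda>s. lapg \<beta> \<epsilon> (x s) j) has_integral (x t2 j - x t1 j)) {t1..t2}"
begin

lemma alive_before: "0 \<le> s \<Longrightarrow> s \<le> t \<Longrightarrow> 0 < x t j \<Longrightarrow> 0 < x s j"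
  using dead[of s t j] nonneg[of s j] by fastforce

lemma cont_sub: "0 \<le> t1 \<Longrightarrow> continuous_on {t1..t2} (\<lambda>t. x t j)"
  by (rule continuous_on_subset[OF cont]) auto

lemma block_eqn:
  assumes "0 \<le> t1" "t1 \<le> t2"
  shows "((\<lambda>s. \<Sum>j=a..b. lapg \<beta> \<epsilon> (x s) j) has_integral
    ((\<Sum>j=a..b. x t2 j) - (\<Sum>j=a..b. x t1 j))) {t1..t2}"
  unfolding sum_subtractf[symmetric] by (intro has_integral_sum eqn assms) auto

lemma powr_le_base: "0 < a \<Longrightarrow> a \<le> z \<Longrightarrow> (z + \<epsilon>) powr (- \<beta>) \<le> a powr (- \<beta>)"
  using beta eps by (intro powr_mono2') auto

text \<open>Above the barrier \<open>D / 2\<close> the loss rate is at most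
  \<open>2 * (D/2) powr (- \<beta>)\<close>. Over the stated time this costs at most
  \<open>D / 4\<close>, strictly less than the available \<open>D / 2\<close>.\<close>

lemma persist:
  assumes "0 \<le> t0" "0 < D" "D \<le> x t0 p" "t0 \<le> t" "t \<le> t0 + 1/4 * (D/2) powr (\<beta> + 1)"
  shows "D / 2 \<le> x t p"
proof (rule barrier(1)[where F = "\<lambda>t. x t p" and f = "\<lambda>s. lapg \<beta> \<epsilon> (x s) p" and c = "2 * (D/2) powr (-\<beta>)"])
  fix s assume s: "t0 \<le> s" "s \<le> t0 + 1/4 * (D/2) powr (\<beta> + 1)"
  show "- (2 * (D/2) powr - \<beta>) \<le> lapg \<beta> \<epsilon> (x s) p" if "D / 2 \<le> x s p"
    using lapg_ge[of "x s" p \<epsilon> \<beta>] powr_le_base[OF _ that] assms(2) by auto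
  have "2 * (D/2) powr - \<beta> * (s - t0) \<le> 2 * (D/2) powr - \<beta> * (1/4 * (D/2) powr (\<beta> + 1))"
    using s by (intro mult_left_mono) auto
  also have "\<dots> = 1/2 * ((D/2) powr (- \<beta>) * (D/2) powr (\<beta> + 1))" by simp
  also have "(D/2) powr (- \<beta>) * (D/2) powr (\<beta> + 1) = D / 2"
    using assms(2) by (subst powr_add[symmetric]) simp
  finally show "D / 2 < x t0 p - 2 * (D/2) powr - \<beta> * (s - t0)" using assms by auto
next
  show "((\<lambda>s. lapg \<beta> \<epsilon> (x s) p) has_integral x v p - x t0 p) {t0..v}" if "t0 \<le> v" for v
    using eqn that assms by auto
qed (use assms cont_sub in auto)

text \<open>The first and the last of the \<open>k\<close> subwindows of length \<open>M\<close>
  contain particles \<open>p\<close> and \<open>q\<close> of size at least \<open>D\<close>, which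
  stay above \<open>D / 2\<close>. The block from \<open>p\<close> to \<open>q\<close> covers the
  \<open>k - 2\<close> middle subwindows and loses at most \<open>D \<le> M * D\<close> through its
  ends, which leaves \<open>(k - 3) * M * D\<close>.\<close>

lemma density_step:
  assumes "0 \<le> t0" "0 < D" "0 < M" "3 \<le> k" and dw: "dense_windows lo hi M D (x t0)"
    and t: "t0 \<le> t" "t \<le> t0 + 1/4 * (D/2) powr (\<beta> + 1)"
  shows "dense_windows lo hi (k * M) ((1 - 3 / of_int k) * D) (x t)"
  unfolding dense_windows_def
proof (intro allI impI)
  fix a assume a: "lo \<le> a \<and> a + k * M \<le> hi + 1"
  have kM: "3 * M \<le> k * M" using assms by auto
  define b where "b = a + (k - 1) * M"
  have ab: "a + 2 * M \<le> b" "b + M = a + k * M" using kM by (auto simp: b_def algebra_simps)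
  note anch = dense_windows_anchored[OF dw assms(3), unfolded anchored_def, rule_format]
  obtain p where p: "p \<in> {a..a+M-1}" "D \<le> x t0 p" using anch[of a] a kM assms(3) by auto
  obtain q where q: "q \<in> {b..b+M-1}" "D \<le> x t0 q" using anch[of b] a ab kM assms(3) by auto
  have pq: "p \<le> q" using p q ab assms(3) by auto
  have D2: "D / 2 \<le> x s r" if "t0 \<le> s" "s \<le> t" "r = p \<or> r = q" for s r
    using persist[of t0 D r s] that assms p q by auto
  let ?g = "(D/2) powr (- \<beta>)"
  have "((\<lambda>s. - (2 * ?g)) has_integral (- (2 * ?g) * (t - t0))) {t0..t}"
    using has_integral_const_real[of "- (2 * ?g)" t0 t] t by (simp add: mult.commute)
  moreover have "- (2 * ?g) \<le> (\<Sum>j=p..q. lapg \<beta> \<epsilon> (x s) j)" if s: "s \<in> {t0..t}" for s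
  proof -
    let ?A = "{k. 0 < x s k}" and ?v = "\<lambda>k. (x s k + \<epsilon>) powr (- \<beta>)"
    have "p \<in> ?A" "q \<in> ?A" "?v p \<le> ?g" "?v q \<le> ?g"
      using D2[of s p] D2[of s q] s assms(2) by (auto intro!: powr_le_base)
    moreover have "0 \<le> lft ?A ?v (p - 1)" "0 \<le> rgt ?A ?v (q + 1)"
      by (auto intro: lft_nonneg rgt_nonneg)
    \<comment> \<open>Both ends are alive, so the outgoing terms \<open>lft\<close> at
      \<open>q\<close> and \<open>rgt\<close> at \<open>p\<close> are the values at \<open>q\<close>
      and \<open>p\<close> themselves.\<close>
    ultimately show ?thesis using pq by (simp add: lapg_def sum_lap)
  qed
  ultimately have "- (2 * ?g) * (t - t0) \<le> (\<Sum>j=p..q. x t j) - (\<Sum>j=p..q. x t0 j)"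
    using has_integral_le[OF _ block_eqn[OF assms(1) t(1)]] by blast
  moreover have "2 * ?g * (t - t0) \<le> D"
  proof -
    have "2 * ?g * (t - t0) \<le> 2 * ?g * (1/4 * (D/2) powr (\<beta> + 1))"
      using t by (intro mult_left_mono) auto
    also have "\<dots> = 1/2 * ((D/2) powr (- \<beta>) * (D/2) powr (\<beta> + 1))" by simp
    also have "(D/2) powr (- \<beta>) * (D/2) powr (\<beta> + 1) = D / 2"
      using assms(2) by (subst powr_add[symmetric]) simp
    finally show ?thesis using assms by auto
  qed
  ultimately have 1: "(\<Sum>j=p..q. x t0 j) - D \<le> (\<Sum>j=p..q. x t j)" by auto
  have "real (nat (k - 2)) * of_int M * D \<le> (\<Sum>j=a+M..a+M+int (nat (k-2))*M-1. x t0 j)"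
    using a assms(3,4) by (intro dense_windows_multiple[OF dw]) (auto simp: algebra_simps)
  also have "\<dots> \<le> (\<Sum>j=p..q. x t0 j)"
    using p q assms ab by (intro sum_mono2 nonneg) (auto simp: b_def algebra_simps)
  finally have 2: "(of_int k - 2) * of_int M * D \<le> (\<Sum>j=p..q. x t0 j)" using assms(4) by simp
  have 3: "(\<Sum>j=p..q. x t j) \<le> (\<Sum>j=a..a+k*M-1. x t j)"
    using p q assms ab t by (intro sum_mono2 nonneg) auto
  have "D \<le> of_int M * D" using assms by simp
  then have "(of_int k - 3) * of_int M * D \<le> (\<Sum>j=a..a+k*M-1. x t j)"
    using 1 2 3 by (simp add: algebra_simps)
  moreover have "of_int k * (1 - 3 / of_int k) = (of_int k - 3 :: real)"
    using assms(4) by (simp add: field_simps)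
  then have "of_int (k * M) * ((1 - 3 / of_int k) * D) = (of_int k - 3) * of_int M * D"
    by (metis mult.assoc mult.commute of_int_mult)
  ultimately show "of_int (k * M) * ((1 - 3 / of_int k) * D) \<le> (\<Sum>j=a..a+k*M-1. x t j)"
    by linarith
qed

end

text \<open>Up to time \<open>T\<close> a fixed number of short time steps suffices; windows are enlarged in every step
  so much that the total loss of density is at most one half.\<close>
lemma anchored_upto:
  assumes "0 < \<beta>" "0 < D" "0 < M" "0 < T"
  shows "\<exists>N>0. \<forall>\<epsilon> x lo hi. coarsening \<beta> \<epsilon> x \<longrightarrow> dense_windows lo hi M D (x 0) \<longrightarrow>
    (\<forall>t\<in>{0..T}. anchored lo hi N (D/2) (x t))"
proof -
  \<comment> \<open>The density stays at least \<open>D / 2\<close> throughout, and half of that is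
    \<open>D / 4\<close>; so \<open>h\<close> is an admissible step length for
    \<open>density_step\<close> in every step.\<close>
  define h where "h = 1/4 * (D/4) powr (\<beta> + 1)"
  have h: "0 < h" using assms by (simp add: h_def)
  define m where "m = nat \<lceil>T / h\<rceil> + 1"
  have m: "0 < m" "T \<le> real m * h"
  proof -
    have "T / h \<le> real m" unfolding m_def by linarith
    then show "T \<le> real m * h" using h by (simp add: field_simps)
  qed (simp add: m_def)
  \<comment> \<open>One step multiplies the density by \<open>1 - 3 / k = 1 - 1 / (2 * m)\<close>,
    and by Bernoulli's inequality \<open>m\<close> such factors leave at least one half.\<close>
  define k where "k = 6 * int m"
  have k: "3 \<le> k" using m by (simp add: k_def)
  define r where "r = 1 - 3 / real_of_int k"
  have r: "r = 1 - 1 / (2 * real m)" using m by (simp add: r_def k_def)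
  have r01: "0 \<le> r" "r \<le> 1" using m by (auto simp: r field_simps)
  have rn: "1/2 \<le> r ^ n" if "n \<le> m" for n
  proof -
    have "1 - real n * (1 / (2 * real m)) \<le> r ^ n"
      using Bernoulli_inequality[of "- (1 / (2 * real m))" n] m by (simp add: r field_simps)
    moreover have "real n * (1 / (2 * real m)) \<le> 1/2" using that m by (simp add: field_simps)
    ultimately show ?thesis by linarith
  qed
  show ?thesis
  proof (intro exI[of _ "k ^ m * M"] conjI allI impI ballI)
    show "0 < k ^ m * M" using k assms by simp
    fix \<epsilon> x lo hi t
    assume co: "coarsening \<beta> \<epsilon> x" and d0: "dense_windows lo hi M D (x 0)" and t: "t \<in> {0..T}"
    interpret coarsening \<beta> \<epsilon> x by fact
    have step: "dense_windows lo hi (k ^ Suc n * M) (r ^ Suc n * D) (x t)"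
      if n: "n < m" "dense_windows lo hi (k ^ n * M) (r ^ n * D) (x (real n * h))"
        and t: "real n * h \<le> t" "t \<le> real (Suc n) * h" for n t
    proof -
      have "1/2 * D \<le> r ^ n * D" using rn[of n] n assms by (intro mult_right_mono) auto
      then have D4: "D / 4 \<le> r ^ n * D / 2" "0 < r ^ n * D" using assms by auto
      have "h \<le> 1/4 * (r ^ n * D / 2) powr (\<beta> + 1)"
        unfolding h_def using D4 assms by (intro mult_left_mono powr_mono2) auto
      then have "dense_windows lo hi (k * (k ^ n * M)) ((1 - 3 / of_int k) * (r ^ n * D)) (x t)"
        using n t h k D4 assms by (intro density_step[of "real n * h"]) (auto simp: algebra_simps)
      then show ?thesis by (simp add: r_def algebra_simps)
    qed
    have dn: "dense_windows lo hi (k ^ n * M) (r ^ n * D) (x (real n * h))" if "n \<le> m" for n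
      using that
    proof (induction n)
      case 0
      then show ?case using d0 by simp
    next
      case (Suc n)
      then show ?case using h by (intro step[of n]) (auto simp: algebra_simps)
    qed
    have "\<exists>n<m. real n * h \<le> t \<and> t \<le> real (Suc n) * h"
    proof (cases "t = 0")
      case True
      then show ?thesis using m h by (intro exI[of _ 0]) auto
    next
      case False
      define n where "n = nat (\<lceil>t / h\<rceil> - 1)"
      have "0 < t / h" using False t h by auto
      then have n: "real n = real_of_int \<lceil>t / h\<rceil> - 1" unfolding n_def by (simp add: le_diff_eq)
      have "t / h \<le> real m" using m t h by (simp add: field_simps)
      then have "real n < real m" using n by linarith
      moreover have "real n \<le> t / h" "t / h \<le> real (Suc n)" using n by linarith+
      ultimately show ?thesis using h by (intro exI[of _ n]) (auto simp: field_simps)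
    qed
    then obtain n where n: "n < m" "real n * h \<le> t" "t \<le> real (Suc n) * h" by auto
    have "anchored lo hi (k ^ Suc n * M) (r ^ Suc n * D) (x t)"
      using step[OF n(1) dn n(2,3)] n k assms by (intro dense_windows_anchored) auto
    then show "anchored lo hi (k ^ m * M) (D/2) (x t)"
    proof (rule anchored_mono)
      show "k ^ Suc n * M \<le> k ^ m * M"
        using n k assms by (intro mult_right_mono power_increasing) auto
      show "D / 2 \<le> r ^ Suc n * D" using rn[of "Suc n"] n assms by (simp add: mult_right_mono[of "1/2" _ D, simplified])
    qed
  qed
qed

section \<open>Lifetime of small particles\<close>

context coarsening begin

text \<open>A cluster of small particles enclosed by two much larger ones loses mass through its two ends,
  and the enclosing particles survive until the cluster has disappeared.\<close>
lemma enclosed_cluster_dies: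
  fixes W :: nat
  defines "\<kappa> \<equiv> 2 * (real W + 2) * (4 + 2 powr (1/\<beta>))"
  assumes "0 \<le> t0" "p < j" "j < q" "q - p \<le> int W + 1" "0 < E" "\<epsilon> \<le> E"
    and small: "\<And>k. p < k \<Longrightarrow> k < q \<Longrightarrow> x t0 k \<le> E"
    and large: "\<kappa> * E \<le> x t0 p" "\<kappa> * E \<le> x t0 q"
  shows "x (t0 + ((real W + 2) * E) powr (\<beta> + 1)) j = 0"
proof (rule ccontr)
  \<comment> \<open>As long as the mass of the cluster is at most \<open>(W + 1) * E\<close>, each
    of its particles has shifted size at most \<open>(W + 2) * E\<close>, hence flux at least
    \<open>c\<close>. The time \<open>h\<close> satisfies \<open>c * h = (W + 2) * E\<close>, which
    exceeds the initial mass of at most \<open>W * E\<close>.\<close>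
  define h where "h = ((real W + 2) * E) powr (\<beta> + 1)"
  define c where "c = ((real W + 2) * E) powr (- \<beta>)"
  define \<mu> where "\<mu> = \<kappa> * E / 2"
  have h: "0 < h" using assms by (simp add: h_def)
  have W2: "0 < (real W + 2) * E" using assms by simp
  have ch: "c * h = (real W + 2) * E"
    using W2 by (simp add: c_def h_def powr_add[symmetric])
  \<comment> \<open>The two summands in \<open>\<kappa>\<close> serve two needs: 4 lets the
    enclosing particles stay above \<open>\<mu>\<close> up to time \<open>h\<close>, and
    \<open>2 powr (1/\<beta>)\<close> makes their joint inflow at most \<open>c\<close>. Since the
    outflow is at least \<open>2 * c\<close>, the net loss is at least \<open>c\<close>.\<close>
  have \<mu>4: "4 * ((real W + 2) * E) \<le> \<mu>" and \<mu>2: "2 powr (1/\<beta>) * ((real W + 2) * E) \<le> \<mu>"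
  proof -
    have "\<mu> = (4 + 2 powr (1/\<beta>)) * ((real W + 2) * E)" by (simp add: \<mu>_def \<kappa>_def)
    then show "4 * ((real W + 2) * E) \<le> \<mu>" "2 powr (1/\<beta>) * ((real W + 2) * E) \<le> \<mu>"
      using W2 by (auto simp: distrib_right intro!: mult_nonneg_nonneg)
  qed
  have "4 powr 1 \<le> 4 powr (\<beta> + 1)" using beta by (intro powr_mono) auto
  then have "h \<le> 1/4 * (4 powr (\<beta> + 1) * h)" using h by simp
  also have "4 powr (\<beta> + 1) * h = (4 * ((real W + 2) * E)) powr (\<beta> + 1)"
    using W2 unfolding h_def by (subst powr_mult[symmetric]) auto
  also have "\<dots> \<le> \<mu> powr (\<beta> + 1)"
    using W2 \<mu>4 beta by (intro powr_mono2) auto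
  finally have hle: "h \<le> 1/4 * \<mu> powr (\<beta> + 1)" by simp
  have "\<mu> powr (- \<beta>) \<le> (2 powr (1/\<beta>) * ((real W + 2) * E)) powr (- \<beta>)"
    using W2 \<mu>2 beta by (intro powr_mono2') auto
  also have "\<dots> = 2 powr (-1) * c"
    using W2 beta by (simp add: powr_mult c_def powr_powr)
  finally have gc: "2 * \<mu> powr (- \<beta>) \<le> c" by (simp add: powr_minus)
  assume "x (t0 + ((real W + 2) * E) powr (\<beta> + 1)) j \<noteq> 0"
  then have jpos: "0 < x (t0 + h) j" using nonneg[of "t0 + h" j] h assms by (simp add: h_def)
  \<comment> \<open>A living \<open>j\<close> guarantees that the first and last living sites seen
    from the two ends lie inside the cluster, so their fluxes are at least \<open>c\<close>.\<close>
  have alive: "0 < x s j" if "t0 \<le> s" "s \<le> t0 + h" for s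
    using alive_before[OF _ that(2) jpos] that assms by simp
  have big: "\<mu> \<le> x s r" if "t0 \<le> s" "s \<le> t0 + h" "r = p \<or> r = q" for s r
  proof -
    have "\<mu> = \<kappa> * E / 2" by (simp add: \<mu>_def)
    also have "\<dots> \<le> x s r"
    proof (rule persist[of t0])
      show "s \<le> t0 + 1 / 4 * (\<kappa> * E / 2) powr (\<beta> + 1)"
        using that(2) hle unfolding \<mu>_def by linarith
      show "0 < \<kappa> * E" using \<mu>4 W2 unfolding \<mu>_def by linarith
    qed (use that assms in auto)
    finally show ?thesis .
  qed
  have \<mu>: "0 < \<mu>" using \<mu>4 W2 by linarith
  define S where "S = (\<lambda>t. \<Sum>k=p+1..q-1. x t k)"
  have S0: "S t0 \<le> real W * E"
  proof -
    have "S t0 \<le> (\<Sum>k=p+1..q-1. E)" unfolding S_def using small by (intro sum_mono) auto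
    also have "\<dots> = real_of_int (q - p - 1) * E" using assms by simp
    also have "\<dots> \<le> real W * E" using assms by (intro mult_right_mono) auto
    finally show ?thesis .
  qed
  have xS: "x s k \<le> S s" if "t0 \<le> s" "p < k" "k < q" for s k
    unfolding S_def using that nonneg[of s] assms by (intro member_le_sum) auto
  have rate: "c \<le> - (\<Sum>k=p+1..q-1. lapg \<beta> \<epsilon> (x s) k)"
    if s: "t0 \<le> s" "s \<le> t0 + h" and le: "- ((real W + 1) * E) \<le> - S s" for s
  proof -
    let ?A = "{k. 0 < x s k}" and ?v = "\<lambda>k. (x s k + \<epsilon>) powr (- \<beta>)"
    have pq: "p \<in> ?A" "q \<in> ?A" "j \<in> ?A" using big[OF s] \<mu> alive[OF s] by force+
    have vpq: "?v p \<le> \<mu> powr (- \<beta>)" "?v q \<le> \<mu> powr (- \<beta>)"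
      using big[OF s] \<mu> by (auto intro: powr_le_base)
    have inner: "c \<le> ?v k" if "p < k" "k < q" "k \<in> ?A" for k
      unfolding c_def
    proof (rule powr_mono2')
      have "x s k + \<epsilon> \<le> (real W + 1) * E + E" using xS[of s k] that s le assms(7) by linarith
      then show "x s k + \<epsilon> \<le> (real W + 2) * E" by (simp add: algebra_simps)
    qed (use that beta eps in auto)
    have "c \<le> lft ?A ?v (q - 1)"
      using lft_cases[OF pq(3), of "q - 1"] inner assms(3,4) by (metis less_le_trans le_less_trans zle_diff1_eq)
    moreover have "c \<le> rgt ?A ?v (p + 1)"
      using rgt_cases[OF pq(3), of "p + 1"] inner assms(3,4) by (metis less_le_trans le_less_trans add1_zle_eq)
    moreover have "(\<Sum>k=p+1..q-1. lapg \<beta> \<epsilon> (x s) k) =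
        ?v p - lft ?A ?v (q - 1) + (?v q - rgt ?A ?v (p + 1))"
      unfolding lapg_def using assms(3,4) pq by (subst sum_lap) auto
    ultimately show ?thesis using vpq gc by linarith
  qed
  have eqS: "((\<lambda>s. - (\<Sum>k=p+1..q-1. lapg \<beta> \<epsilon> (x s) k)) has_integral (- S v - (- S t0))) {t0..v}"
    if "t0 \<le> v" for v
    using has_integral_neg[OF block_eqn[of t0 v "p+1" "q-1"]] that assms by (simp add: S_def)
  \<comment> \<open>With a negative loss rate, \<open>barrier\<close> says that \<open>S\<close>
    stays below \<open>(W + 1) * E\<close> and decreases at least at rate \<open>c\<close>.\<close>
  have "- S t0 - (- c) * (t0 + h - t0) \<le> - S (t0 + h)"
  proof (rule barrier(2)[where F = "\<lambda>t. - S t" and ?t1.0 = "t0 + h" and a = "- ((real W + 1) * E)"])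
    show "continuous_on {t0..t0 + h} (\<lambda>t. - S t)"
      unfolding S_def using assms by (intro continuous_intros cont_sub) auto
    show "- ((real W + 1) * E) < - S t0 - (- c) * (s - t0)" if "t0 \<le> s" for s
    proof -
      have "0 \<le> c * (s - t0)" using that by (simp add: c_def)
      moreover have "real W * E < (real W + 1) * E" using assms by simp
      ultimately show ?thesis using S0 by simp
    qed
  qed (use rate eqS h in auto)
  moreover have "0 \<le> S (t0 + h)" unfolding S_def using nonneg assms h by (intro sum_nonneg) auto
  ultimately have "(real W + 2) * E \<le> real W * E" using ch S0 by simp
  then show False using assms by simp
qed

text \<open>If no scale gap is found at the level of the enclosing particles, one of the inner particles
  is large and yields a shorter enclosing interval.\<close>
lemma cluster_dies:
  fixes W :: nat
  defines "\<kappa> \<equiv> 2 * (real W + 2) * (4 + 2 powr (1/\<beta>))"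
  assumes t0: "0 \<le> t0" and e: "0 < e" "\<epsilon> \<le> e" "x t0 j \<le> e"
    and pq: "p < j" "j < q" "q - p \<le> int n" "n \<le> W + 1"
    and large: "\<kappa> ^ n * e \<le> x t0 p" "\<kappa> ^ n * e \<le> x t0 q"
  shows "x (t0 + ((real W + 2) * (\<kappa> ^ W * e)) powr (\<beta> + 1)) j = 0"
  using pq large
proof (induction n arbitrary: p q)
  case (Suc n)
  have k1: "1 \<le> \<kappa>"
  proof -
    have "1 * 1 \<le> 2 * (real W + 2) * (4 + 2 powr (1/\<beta>))" by (intro mult_mono) auto
    then show ?thesis by (simp add: \<kappa>_def)
  qed
  have kS: "\<kappa> ^ n * e \<le> \<kappa> ^ Suc n * e" using k1 e by (intro mult_right_mono power_increasing) auto
  show ?case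
  proof (cases "\<forall>k. p < k \<and> k < q \<longrightarrow> x t0 k \<le> \<kappa> ^ n * e")
    case True
    have 1: "e \<le> \<kappa> ^ n * e" using k1 e by simp
    have 2: "\<kappa> ^ n * e \<le> \<kappa> ^ W * e" using k1 e Suc.prems by (intro mult_right_mono power_increasing) auto
    have "x (t0 + ((real W + 2) * (\<kappa> ^ n * e)) powr (\<beta> + 1)) j = 0"
    proof (rule enclosed_cluster_dies[of t0 p j q W, folded \<kappa>_def])
      show "\<epsilon> \<le> \<kappa> ^ n * e" using 1 e by linarith
    qed (use True Suc.prems e 1 t0 in \<open>auto simp: mult.assoc\<close>)
    then show ?thesis
    proof (rule dead[rotated 2])
      show "t0 + ((real W + 2) * (\<kappa> ^ n * e)) powr (\<beta> + 1) \<le> t0 + ((real W + 2) * (\<kappa> ^ W * e)) powr (\<beta> + 1)"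
        using 1 2 e beta by (intro add_left_mono powr_mono2 mult_left_mono) auto
    qed (use t0 in auto)
  next
    case False
    \<comment> \<open>Replacing \<open>p\<close> or \<open>q\<close> by \<open>k\<close> shortens
      the interval by at least one site and lowers the required level by one factor
      \<open>\<kappa>\<close>. With \<open>n = 0\<close> no room is left for \<open>j\<close>, so
      the base case is void.\<close>
    then obtain k where k: "p < k" "k < q" "\<kappa> ^ n * e < x t0 k" by (auto simp: not_le)
    have "e \<le> \<kappa> ^ n * e" using k1 e by simp
    then have "x t0 j < x t0 k" using k e by linarith
    then have "k \<noteq> j" by auto
    then consider "k < j" | "j < k" by linarith
    then show ?thesis
    proof cases
      case 1
      then show ?thesis using Suc.prems k kS by (intro Suc.IH[of k q]) auto
    next
      case 2
      then show ?thesis using Suc.prems k kS by (intro Suc.IH[of p k]) auto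
    qed
  qed
qed auto

lemma vanishing_time:
  assumes "0 \<le> u" "x u k = 0"
  obtains \<tau> where "0 \<le> \<tau>" "\<tau> \<le> u" "\<And>s. 0 \<le> s \<Longrightarrow> s < \<tau> \<Longrightarrow> 0 < x s k" "\<And>s. \<tau> \<le> s \<Longrightarrow> x s k = 0"
proof -
  define B where "B = {0..} \<inter> (\<lambda>t. x t k) -` {0}"
  have "closed B" unfolding B_def by (intro continuous_closed_preimage cont) auto
  have ne: "u \<in> B" using assms by (auto simp: B_def)
  have bd: "bdd_below B" by (auto simp: B_def bdd_below_def)
  have B: "Inf B \<in> B" using closed_contains_Inf[OF _ bd \<open>closed B\<close>] ne by auto
  show thesis
  proof
    show "0 \<le> Inf B" using B by (auto simp: B_def)
    show "Inf B \<le> u" using cInf_lower[OF ne bd] .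
    show "0 < x s k" if "0 \<le> s" "s < Inf B" for s
    proof -
      have "s \<notin> B" using cInf_lower[OF _ bd, of s] that by auto
      then show ?thesis using that nonneg[of s k] by (auto simp: B_def)
    qed
    show "x s k = 0" if "Inf B \<le> s" for s
      using dead[of "Inf B" s k] B that by (auto simp: B_def)
  qed
qed

end

text \<open>Surviving until \<open>s\<close> forces a minimal size at \<open>t\<close>. Large
  particles lie within \<open>N\<close> sites on either side of \<open>j\<close>, hence
  \<open>W = 2 * N\<close>. If \<open>e\<close> is small compared with \<open>D\<close>, the cluster
  estimate gives the constant \<open>A\<close>; otherwise \<open>e\<close> is bounded below and the
  trivial bound \<open>s - t \<le> T\<close> is absorbed by \<open>B\<close>. The size is measured
  as \<open>x t j + \<epsilon>\<close> because \<open>cluster_dies\<close> needs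
  \<open>\<epsilon> \<le> e\<close>.\<close>

lemma small_particles_die:
  assumes "0 < \<beta>" "0 < D" "0 < N" "0 < T"
  shows "\<exists>K>0. \<forall>\<epsilon> x lo hi. coarsening \<beta> \<epsilon> x \<longrightarrow> (\<forall>t\<in>{0..T}. anchored lo hi N D (x t)) \<longrightarrow>
    (\<forall>j t s. lo + N \<le> j \<and> j + N \<le> hi \<and> 0 \<le> t \<and> t \<le> s \<and> s \<le> T \<and> 0 < x s j \<longrightarrow>
       K * (s - t) \<le> (x t j + \<epsilon>) powr (\<beta> + 1))"
proof -
  define W where "W = nat (2 * N)"
  have W: "int W = 2 * N" "0 < W" using assms by (auto simp: W_def)
  define \<kappa> where "\<kappa> = 2 * (real W + 2) * (4 + 2 powr (1/\<beta>))"
  have \<kappa>: "0 < \<kappa>" unfolding \<kappa>_def using W by (intro mult_pos_pos add_pos_nonneg) auto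
  define A where "A = ((real W + 2) * \<kappa> ^ W) powr (\<beta> + 1)"
  define B where "B = T * (\<kappa> ^ W / D) powr (\<beta> + 1)"
  have AB: "0 < A" "0 < B" using \<kappa> assms by (auto simp: A_def B_def)
  show ?thesis
  proof (intro exI[of _ "1 / (A + B)"] conjI allI impI)
    show "0 < 1 / (A + B)" using AB by simp
    fix \<epsilon> x lo hi j t s
    assume co: "coarsening \<beta> \<epsilon> x" and anch: "\<forall>t\<in>{0..T}. anchored lo hi N D (x t)"
      and *: "lo + N \<le> j \<and> j + N \<le> hi \<and> 0 \<le> t \<and> t \<le> s \<and> s \<le> T \<and> 0 < x s j"
    interpret coarsening \<beta> \<epsilon> x by fact
    define e where "e = x t j + \<epsilon>"
    have e: "0 < e" "\<epsilon> \<le> e" "x t j \<le> e"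
      using alive_before[of t s j] * eps by (auto simp: e_def)
    have an: "\<exists>p\<in>{a..a+N-1}. D \<le> x t p" if "lo \<le> a" "a + N \<le> hi + 1" for a
      using anch that * unfolding anchored_def by auto
    obtain p where p: "p \<in> {j-N..j-1}" "D \<le> x t p" using an[of "j - N"] * assms by auto
    obtain q where q: "q \<in> {j+1..j+N}" "D \<le> x t q" using an[of "j + 1"] * assms by (auto simp: algebra_simps)
    have "s - t \<le> (A + B) * e powr (\<beta> + 1)"
    proof (cases "\<kappa> ^ W * e \<le> D")
      case True
      have "x (t + ((real W + 2) * (\<kappa> ^ W * e)) powr (\<beta> + 1)) j = 0"
        using * e p q True assms W
        by (intro cluster_dies[where n = W and p = p and q = q and W = W, folded \<kappa>_def]) auto
      then have "s \<le> t + ((real W + 2) * (\<kappa> ^ W * e)) powr (\<beta> + 1)"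
        using dead[of _ s j] * by (metis add_nonneg_nonneg less_irrefl linorder_le_cases powr_ge_zero)
      also have "((real W + 2) * (\<kappa> ^ W * e)) powr (\<beta> + 1) = A * e powr (\<beta> + 1)"
        using \<kappa> e unfolding A_def by (subst powr_mult[symmetric]) (auto simp: mult.assoc)
      also have "\<dots> \<le> (A + B) * e powr (\<beta> + 1)" using AB by (intro mult_right_mono) auto
      finally show ?thesis by simp
    next
      case False
      have "1 powr (\<beta> + 1) \<le> (\<kappa> ^ W / D * e) powr (\<beta> + 1)"
        using False assms \<kappa> e by (intro powr_mono2) (auto simp: field_simps)
      then have "T * 1 \<le> T * (\<kappa> ^ W / D * e) powr (\<beta> + 1)" using assms by (intro mult_left_mono) auto
      also have "\<dots> = B * e powr (\<beta> + 1)"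
        using \<kappa> e assms unfolding B_def by (simp add: powr_mult powr_divide)
      also have "\<dots> \<le> (A + B) * e powr (\<beta> + 1)" using AB by (intro mult_right_mono) auto
      finally show ?thesis using * by linarith
    qed
    then show "1 / (A + B) * (s - t) \<le> (x t j + \<epsilon>) powr (\<beta> + 1)"
      using AB by (simp add: e_def field_simps)
  qed
qed

section \<open>Hoelder bounds\<close>

text \<open>This is the bound on the reciprocal power of a particle with vanishing time
  \<open>\<tau>\<close> that follows from (4). Its exponent exceeds -1, and its integral scales like
  the power \<open>1 / (\<beta> + 1)\<close> of the length, which is the origin of the Hoelder
  exponent.\<close>

definition kern :: "real \<Rightarrow> real \<Rightarrow> real \<Rightarrow> real \<Rightarrow> real" where
  "kern K \<beta> \<tau> s = (if s < \<tau> then (K * (\<tau> - s)) powr (- \<beta> / (\<beta> + 1)) else 0)"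

lemma kern_nonneg: "0 \<le> kern K \<beta> \<tau> s"
  by (simp add: kern_def)

lemma kern_integral:
  assumes "0 < \<beta>" "0 < K" "t1 \<le> \<tau>" "\<tau> \<le> t2"
  shows "(kern K \<beta> \<tau> has_integral K powr (- \<beta> / (\<beta> + 1)) * (\<beta> + 1) * (\<tau> - t1) powr (1 / (\<beta> + 1))) {t1..t2}"
proof -
  let ?c = "K powr (- \<beta> / (\<beta> + 1)) * (\<beta> + 1)"
  let ?F = "\<lambda>s. - ?c * (\<tau> - s) powr (1 / (\<beta> + 1))"
  have ex: "1 / (\<beta> + 1) - 1 = - \<beta> / (\<beta> + 1)" using assms by (simp add: field_simps)
  have "(kern K \<beta> \<tau> has_integral (?F \<tau> - ?F t1)) {t1..\<tau>}"
  proof (rule fundamental_theorem_of_calculus_interior[OF assms(3)])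
    show "continuous_on {t1..\<tau>} ?F"
      using assms by (intro continuous_intros continuous_on_powr') auto
    show "(?F has_vector_derivative kern K \<beta> \<tau> s) (at s)" if "s \<in> {t1<..<\<tau>}" for s
    proof -
      have "(?F has_real_derivative - ?c * (1 / (\<beta> + 1) * (\<tau> - s) powr (1 / (\<beta> + 1) - 1) * (0 - 1))) (at s)"
        using that by (intro derivative_eq_intros refl | simp)+
      also have "- ?c * (1 / (\<beta> + 1) * (\<tau> - s) powr (1 / (\<beta> + 1) - 1) * (0 - 1)) = kern K \<beta> \<tau> s"
        using that assms unfolding ex by (simp add: kern_def powr_mult)
      finally show ?thesis by (simp add: has_real_derivative_iff_has_vector_derivative)
    qed
  qed
  moreover have "(kern K \<beta> \<tau> has_integral 0) {\<tau>..t2}"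
    by (rule has_integral_is_0) (simp add: kern_def)
  ultimately have "(kern K \<beta> \<tau> has_integral (?F \<tau> - ?F t1 + 0)) {t1..t2}"
    by (rule has_integral_combine[OF assms(3,4)])
  then show ?thesis using assms by simp
qed

text \<open>The neighbours of \<open>j\<close> change in time but always lie between
  \<open>p\<close> and \<open>q\<close>. The sum over all living sites of the window bounds the
  right-hand side without tracking them; the factor 2 comes from the centre term and also covers the
  two neighbours.\<close>

lemma lapg_abs_le:
  assumes p: "p \<in> {j - N..j - 1}" "0 < z p" and q: "q \<in> {j + 1..j + N}" "0 < z q"
  shows "\<bar>lapg \<beta> \<epsilon> z j\<bar> \<le> 2 * (\<Sum>k=j-N..j+N. if 0 < z k then (z k + \<epsilon>) powr (- \<beta>) else 0)"
proof -
  let ?A = "{k. 0 < z k}" and ?v = "\<lambda>k. (z k + \<epsilon>) powr (- \<beta>)"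
  let ?G = "\<lambda>k. if 0 < z k then ?v k else 0"
  let ?S = "\<Sum>k=j-N..j+N. ?G k"
  have mem: "?v k \<le> ?S" if "k \<in> {j-N..j+N}" "0 < z k" for k
    using member_le_sum[of k "{j-N..j+N}" ?G] that by auto
  have S: "0 \<le> ?S" by (intro sum_nonneg) auto
  show ?thesis
  proof (cases "0 < z j")
    case True
    obtain k where k: "k \<in> ?A" "p \<le> k" "k \<le> j - 1" "\<And>v. lft ?A v (j - 1) = v k"
      using lft_cases[of p ?A "j - 1"] p by auto
    obtain l where l: "l \<in> ?A" "j + 1 \<le> l" "l \<le> q" "\<And>v. rgt ?A v (j + 1) = v l"
      using rgt_cases[of q ?A "j + 1"] q by auto
    have "lapg \<beta> \<epsilon> z j = ?v k - 2 * ?v j + ?v l"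
      using True by (simp add: lapg_def lap_mem k l)
    moreover have "?v k \<le> ?S" "?v l \<le> ?S" "?v j \<le> ?S"
      using k l p q True by (auto intro!: mem)
    moreover have "0 \<le> ?v k" "0 \<le> ?v l" "0 \<le> ?v j" by auto
    ultimately show ?thesis by linarith
  next
    case False
    then show ?thesis using S by (simp add: lapg_def lap_notmem)
  qed
qed

context coarsening begin

text \<open>\<open>\<tau>\<close> is the vanishing time of \<open>k\<close> clipped to
  \<open>t1..t2\<close>. The end point \<open>t2\<close> is excluded: \<open>kern\<close> is 0 from
  \<open>\<tau>\<close> on, whereas the particle may be alive at \<open>\<tau> = t2\<close>.\<close>

lemma reciprocal_le_kern:
  assumes lower: "\<And>t s. 0 \<le> t \<Longrightarrow> t \<le> s \<Longrightarrow> s \<le> T \<Longrightarrow> 0 < x s k \<Longrightarrow> K * (s - t) \<le> (x t k + \<epsilon>) powr (\<beta> + 1)"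
    and K: "0 < K" and t: "0 \<le> t1" "t1 \<le> t2" "t2 \<le> T"
  shows "\<exists>\<tau>\<in>{t1..t2}. \<forall>s\<in>{t1..<t2}. 0 < x s k \<longrightarrow> (x s k + \<epsilon>) powr (- \<beta>) \<le> kern K \<beta> \<tau> s"
proof -
  have main: "(x s k + \<epsilon>) powr (- \<beta>) \<le> kern K \<beta> \<tau> s"
    if s: "0 \<le> s" "s < \<tau>" and \<tau>: "\<tau> \<le> T" "\<And>r. s < r \<Longrightarrow> r < \<tau> \<Longrightarrow> 0 < x r k" and pos: "0 < x s k" for s \<tau>
  proof -
    \<comment> \<open>\<open>lower\<close> needs a living particle at the later time, so it is
      applied before \<open>\<tau>\<close> and the bound is obtained by density.\<close>
    have "\<tau> - s \<le> (x s k + \<epsilon>) powr (\<beta> + 1) / K"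
    proof (rule dense_le)
      fix y assume y: "y < \<tau> - s"
      show "y \<le> (x s k + \<epsilon>) powr (\<beta> + 1) / K"
      proof (cases "0 < y")
        case True
        then show ?thesis using lower[of s "s + y"] s \<tau> K y by (simp add: field_simps)
      next
        case False
        then have "y \<le> 0" by simp
        also have "0 \<le> (x s k + \<epsilon>) powr (\<beta> + 1) / K" using K by simp
        finally show ?thesis .
      qed
    qed
    then have "K * (\<tau> - s) \<le> (x s k + \<epsilon>) powr (\<beta> + 1)" using K by (simp add: field_simps)
    then have "((x s k + \<epsilon>) powr (\<beta> + 1)) powr (- \<beta> / (\<beta> + 1)) \<le> (K * (\<tau> - s)) powr (- \<beta> / (\<beta> + 1))"
      using K s beta by (intro powr_mono2') auto
    then show ?thesis using s beta by (simp add: kern_def powr_powr)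
  qed
  show ?thesis
  proof (cases "0 < x t2 k")
    case True
    have "(x s k + \<epsilon>) powr (- \<beta>) \<le> kern K \<beta> t2 s" if "s \<in> {t1..<t2}" for s
      using that t alive_before[OF _ _ True] by (intro main) auto
    then show ?thesis using t by (intro bexI[of _ t2]) auto
  next
    case False
    then have "x t2 k = 0" using nonneg[of t2 k] t by simp
    then obtain \<tau> where \<tau>: "0 \<le> \<tau>" "\<tau> \<le> t2" "\<And>s. 0 \<le> s \<Longrightarrow> s < \<tau> \<Longrightarrow> 0 < x s k" "\<And>s. \<tau> \<le> s \<Longrightarrow> x s k = 0"
      using vanishing_time[of t2 k] t by auto
    have "(x s k + \<epsilon>) powr (- \<beta>) \<le> kern K \<beta> (max t1 \<tau>) s" if "s \<in> {t1..<t2}" "0 < x s k" for s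
    proof -
      have "s < \<tau>" using \<tau>(4)[of s] that by fastforce
      then show ?thesis using that t \<tau> by (simp add: max_def) (intro main conjI impI; auto)
    qed
    then show ?thesis using t \<tau> by (intro bexI[of _ "max t1 \<tau>"]) auto
  qed
qed

text \<open>The majorant is twice the sum of the kernels of the \<open>2 * N + 1\<close> sites
  around \<open>j\<close>. It depends on their vanishing times, but its integral does not exceed a
  uniform bound. It is kept explicit because it gives the Hoelder estimate as well as Lebesgue
  integrability.\<close>

lemma rate_dominated:
  assumes K: "0 < K" and D: "0 < D" and N: "0 < N"
    and anch: "\<And>t. 0 \<le> t \<Longrightarrow> t \<le> T \<Longrightarrow> anchored lo hi N D (x t)"
    and lower: "\<And>t s j. lo + N \<le> j \<Longrightarrow> j + N \<le> hi \<Longrightarrow> 0 \<le> t \<Longrightarrow> t \<le> s \<Longrightarrow> s \<le> T \<Longrightarrow> 0 < x s j \<Longrightarrow>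
      K * (s - t) \<le> (x t j + \<epsilon>) powr (\<beta> + 1)"
    and j: "lo + 2 * N \<le> j" "j + 2 * N \<le> hi" and t: "0 \<le> t1" "t1 \<le> t2" "t2 \<le> T"
  shows "\<exists>H I. (H has_integral I) {t1..t2} \<and> (\<forall>s. 0 \<le> H s) \<and>
    I \<le> 2 * (2 * of_int N + 1) * (K powr (- \<beta> / (\<beta> + 1)) * (\<beta> + 1)) * (t2 - t1) powr (1 / (\<beta> + 1)) \<and>
    (\<forall>s\<in>{t1..<t2}. \<bar>lapg \<beta> \<epsilon> (x s) j\<bar> \<le> H s \<and> (0 < x s j \<longrightarrow> (x s j + \<epsilon>) powr (- \<beta>) \<le> H s))"
proof -
  let ?c = "K powr (- \<beta> / (\<beta> + 1)) * (\<beta> + 1)"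
  have "\<forall>k\<in>{j-N..j+N}. \<exists>\<tau>\<in>{t1..t2}. \<forall>s\<in>{t1..<t2}. 0 < x s k \<longrightarrow> (x s k + \<epsilon>) powr (- \<beta>) \<le> kern K \<beta> \<tau> s"
    using j t N by (intro ballI reciprocal_le_kern[of T] lower K) auto
  then obtain \<tau> where \<tau>: "\<And>k. k \<in> {j-N..j+N} \<Longrightarrow> \<tau> k \<in> {t1..t2}"
    "\<And>k s. k \<in> {j-N..j+N} \<Longrightarrow> s \<in> {t1..<t2} \<Longrightarrow> 0 < x s k \<Longrightarrow> (x s k + \<epsilon>) powr (- \<beta>) \<le> kern K \<beta> (\<tau> k) s"
    by metis
  define H where "H = (\<lambda>s. 2 * (\<Sum>k=j-N..j+N. kern K \<beta> (\<tau> k) s))"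
  define I where "I = 2 * (\<Sum>k=j-N..j+N. ?c * (\<tau> k - t1) powr (1 / (\<beta> + 1)))"
  have "(H has_integral I) {t1..t2}"
    unfolding H_def I_def using \<tau>(1) K beta
    by (intro has_integral_mult_right has_integral_sum kern_integral) auto
  moreover have "0 \<le> H s" for s unfolding H_def by (intro mult_nonneg_nonneg sum_nonneg kern_nonneg) auto
  moreover have "I \<le> 2 * (2 * of_int N + 1) * ?c * (t2 - t1) powr (1 / (\<beta> + 1))"
  proof -
    have "I \<le> 2 * (\<Sum>k=j-N..j+N. ?c * (t2 - t1) powr (1 / (\<beta> + 1)))"
      unfolding I_def using \<tau>(1) beta
      by (intro mult_left_mono sum_mono powr_mono2) auto
    also have "\<dots> = 2 * (2 * of_int N + 1) * ?c * (t2 - t1) powr (1 / (\<beta> + 1))"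
      using N by simp
    finally show ?thesis .
  qed
  moreover have "\<bar>lapg \<beta> \<epsilon> (x s) j\<bar> \<le> H s \<and> (0 < x s j \<longrightarrow> (x s j + \<epsilon>) powr (- \<beta>) \<le> H s)"
    if s: "s \<in> {t1..<t2}" for s
  proof
    have "anchored lo hi N D (x s)" using anch s t by auto
    then have an: "\<exists>p\<in>{a..a+N-1}. D \<le> x s p" if "lo \<le> a" "a + N \<le> hi + 1" for a
      using that unfolding anchored_def by auto
    obtain p where p: "p \<in> {j-N..j-1}" "D \<le> x s p" using an[of "j - N"] j N by auto
    obtain q where q: "q \<in> {j+1..j+N}" "D \<le> x s q" using an[of "j + 1"] j N by (auto simp: algebra_simps)
    have "\<bar>lapg \<beta> \<epsilon> (x s) j\<bar> \<le> 2 * (\<Sum>k=j-N..j+N. if 0 < x s k then (x s k + \<epsilon>) powr (- \<beta>) else 0)"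
      using p q D by (intro lapg_abs_le[of p _ _ _ q]) auto
    also have "\<dots> \<le> H s"
      unfolding H_def using \<tau>(2) s by (intro mult_left_mono sum_mono) (auto simp: kern_nonneg)
    finally show "\<bar>lapg \<beta> \<epsilon> (x s) j\<bar> \<le> H s" .
    have "kern K \<beta> (\<tau> j) s \<le> (\<Sum>k=j-N..j+N. kern K \<beta> (\<tau> k) s)"
      using N by (intro member_le_sum[of j _ "\<lambda>k. kern K \<beta> (\<tau> k) s"]) (auto simp: kern_nonneg)
    moreover have "0 \<le> (\<Sum>k=j-N..j+N. kern K \<beta> (\<tau> k) s)" by (intro sum_nonneg kern_nonneg)
    ultimately have "kern K \<beta> (\<tau> j) s \<le> H s" unfolding H_def by simp
    then show "0 < x s j \<longrightarrow> (x s j + \<epsilon>) powr (- \<beta>) \<le> H s" using \<tau>(2)[of j s] s N by force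
  qed
  ultimately show ?thesis by blast
qed

lemma increment_le:
  assumes "(H has_integral I) {t1..t2}" "\<forall>s\<in>{t1..<t2}. \<bar>lapg \<beta> \<epsilon> (x s) j\<bar> \<le> H s" "0 \<le> t1" "t1 \<le> t2"
  shows "\<bar>x t2 j - x t1 j\<bar> \<le> I"
proof -
  let ?f = "\<lambda>s. if s = t2 then 0 else lapg \<beta> \<epsilon> (x s) j" and ?H = "\<lambda>s. if s = t2 then 0 else H s"
  have f: "(?f has_integral (x t2 j - x t1 j)) {t1..t2}"
    by (rule has_integral_spike_finite[OF _ _ eqn[OF assms(3,4)], of "{t2}"]) auto
  have H: "(?H has_integral I) {t1..t2}"
    by (rule has_integral_spike_finite[OF _ _ assms(1), of "{t2}"]) auto
  have "x t2 j - x t1 j \<le> I"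
    by (rule has_integral_le[OF f H]) (use assms(2) in force)
  moreover have "- (x t2 j - x t1 j) \<le> I"
    by (rule has_integral_le[OF has_integral_neg[OF f] H]) (use assms(2) in force)
  ultimately show ?thesis by linarith
qed

end

section \<open>A priori estimates uniform in the regularisation and the range\<close>

definition dominated_rate where
  "dominated_rate \<beta> \<epsilon> C x t1 t2 j \<longleftrightarrow> (\<exists>H I. (H has_integral I) {t1..t2} \<and> (\<forall>s. 0 \<le> H s) \<and>
    I \<le> C * (t2 - t1) powr (1 / (\<beta> + 1)) \<and>
    (\<forall>s\<in>{t1..<t2::real}. \<bar>lapg \<beta> \<epsilon> (x s) j\<bar> \<le> H s \<and> (0 < x s j \<longrightarrow> (x s j + \<epsilon>) powr (- \<beta>) \<le> H s)))"

text \<open>The margins reflect dependence: the lower bound at \<open>j\<close> uses large particles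
  within distance \<open>N\<close>, and the rate at \<open>j\<close> uses the lower bound at sites
  within distance \<open>N\<close>, hence \<open>2 * N\<close>.\<close>

definition apriori_bounds where
  "apriori_bounds \<beta> D T N K C \<epsilon> x lo hi \<longleftrightarrow>
    (\<forall>t\<in>{0..T}. anchored lo hi N (D/2) (x t)) \<and>
    (\<forall>j t s. lo + N \<le> j \<and> j + N \<le> hi \<and> 0 \<le> t \<and> t \<le> s \<and> s \<le> T \<and> 0 < x s j \<longrightarrow>
       K * (s - t) \<le> (x t j + \<epsilon>) powr (\<beta> + 1)) \<and>
    (\<forall>j t1 t2. lo + 2 * N \<le> j \<and> j + 2 * N \<le> hi \<and> 0 \<le> t1 \<and> t1 \<le> t2 \<and> t2 \<le> T \<longrightarrow>
       dominated_rate \<beta> \<epsilon> C x t1 t2 j \<and>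
       \<bar>x t2 j - x t1 j\<bar> \<le> C * (t2 - t1) powr (1 / (\<beta> + 1)))"

text \<open>The estimates serve twice: for compactness of the approximations, and again with
  \<epsilon> = 0 for the solution obtained as their limit, so the properties claimed of the solution
  need not be passed to the limit.\<close>

theorem apriori:
  assumes "0 < \<beta>" "0 < D" "0 < M" "0 < T"
  shows "\<exists>N K C. 0 < N \<and> 0 < K \<and> 0 \<le> C \<and> (\<forall>\<epsilon> x lo hi. coarsening \<beta> \<epsilon> x \<longrightarrow>
    dense_windows lo hi M D (x 0) \<longrightarrow> apriori_bounds \<beta> D T N K C \<epsilon> x lo hi)"
proof -
  obtain N where N: "0 < N" "\<And>\<epsilon> x lo hi. coarsening \<beta> \<epsilon> x \<Longrightarrow> dense_windows lo hi M D (x 0) \<Longrightarrow>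
    (\<forall>t\<in>{0..T}. anchored lo hi N (D/2) (x t))"
    using anchored_upto[OF assms] by auto
  obtain K where K: "0 < K" "\<And>\<epsilon> x lo hi. coarsening \<beta> \<epsilon> x \<Longrightarrow> (\<forall>t\<in>{0..T}. anchored lo hi N (D/2) (x t)) \<Longrightarrow>
    (\<forall>j t s. lo + N \<le> j \<and> j + N \<le> hi \<and> 0 \<le> t \<and> t \<le> s \<and> s \<le> T \<and> 0 < x s j \<longrightarrow>
       K * (s - t) \<le> (x t j + \<epsilon>) powr (\<beta> + 1))"
    using small_particles_die[of \<beta> "D/2" N T] N(1) assms by auto
  define C where "C = 2 * (2 * of_int N + 1) * (K powr (- \<beta> / (\<beta> + 1)) * (\<beta> + 1))"
  have C: "0 \<le> C" using N(1) assms by (simp add: C_def)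
  have "apriori_bounds \<beta> D T N K C \<epsilon> x lo hi"
    if co: "coarsening \<beta> \<epsilon> x" and dw: "dense_windows lo hi M D (x 0)" for \<epsilon> x lo hi
  proof -
    interpret coarsening \<beta> \<epsilon> x by fact
    note an = N(2)[OF co dw]
    note lower = K(2)[OF co an]
    have dr: "dominated_rate \<beta> \<epsilon> C x t1 t2 j"
      if "lo + 2 * N \<le> j" "j + 2 * N \<le> hi" "0 \<le> t1" "t1 \<le> t2" "t2 \<le> T" for t1 t2 j
      unfolding dominated_rate_def C_def
      using that an lower assms N(1) K(1)
      by (intro rate_dominated[where T = T and lo = lo and hi = hi and D = "D/2"]) auto
    moreover have "\<bar>x t2 j - x t1 j\<bar> \<le> C * (t2 - t1) powr (1 / (\<beta> + 1))"
      if "lo + 2 * N \<le> j" "j + 2 * N \<le> hi" "0 \<le> t1" "t1 \<le> t2" "t2 \<le> T" for t1 t2 j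
      using dr[OF that] increment_le[of _ _ t1 t2 j] that unfolding dominated_rate_def by (meson order_trans)
    ultimately show ?thesis unfolding apriori_bounds_def using an lower by blast
  qed
  then show ?thesis using N(1) K(1) C by blast
qed

section \<open>Picard iteration\<close>

lemma continuous_on_half_line:
  fixes f :: "real \<Rightarrow> real"
  assumes "0 \<le> B" "\<And>s t. 0 \<le> s \<Longrightarrow> s \<le> t \<Longrightarrow> \<bar>f t - f s\<bar> \<le> B * (t - s)"
  shows "continuous_on {0..} f"
proof (rule lipschitz_on_continuous_on)
  show "B-lipschitz_on {0..} f"
  proof (rule lipschitz_onI)
    fix s t :: real assume "s \<in> {0..}" "t \<in> {0..}"
    then show "dist (f s) (f t) \<le> B * dist s t"
      using assms(2)[of s t] assms(2)[of t s] by (cases "s \<le> t") (auto simp: dist_real_def abs_minus_commute)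
  qed fact
qed

text \<open>Two notions of continuity cooperate. The Lipschitz bound in the supremum distance makes
  successive iterates differ by \<open>B * \<Lambda> ^ n * t ^ Suc n / fact (Suc n)\<close>.
  Coordinatewise sequential continuity makes the integrands continuous in time and identifies the
  limit.\<close>

lemma picard:
  fixes F :: "(int \<Rightarrow> real) \<Rightarrow> int \<Rightarrow> real" and y0 :: "int \<Rightarrow> real"
  assumes L: "0 \<le> \<Lambda>" and B: "0 \<le> B" and bound: "\<And>y j. \<bar>F y j\<bar> \<le> B"
    and lip: "\<And>y w e j. (\<forall>k. \<bar>y k - w k\<bar> \<le> e) \<Longrightarrow> \<bar>F y j - F w j\<bar> \<le> \<Lambda> * e"
    and seq: "\<And>u l j. (\<forall>k. (\<lambda>n. u n k) \<longlonglongrightarrow> l k) \<Longrightarrow> (\<lambda>n. F (u n) j) \<longlonglongrightarrow> F l j"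
  obtains y where "y 0 = y0" "\<And>j. continuous_on {0..} (\<lambda>t. y t j)"
    "\<And>j t1 t2. 0 \<le> t1 \<Longrightarrow> t1 \<le> t2 \<Longrightarrow> ((\<lambda>s. F (y s) j) has_integral (y t2 j - y t1 j)) {t1..t2::real}"
proof -
  define Y where "Y = rec_nat (\<lambda>t. y0) (\<lambda>n Yn (t::real) j. y0 j + integral {0..t} (\<lambda>s. F (Yn s) j))"
  have Y0: "Y 0 t j = y0 j" and YS: "Y (Suc n) t j = y0 j + integral {0..t} (\<lambda>s. F (Y n s) j)" for n t j
    by (simp_all add: Y_def)
  have contF: "continuous_on {0..} (\<lambda>s. F (y s) j)" if "\<And>k. continuous_on {0..} (\<lambda>s. y s k)" for y :: "real \<Rightarrow> int \<Rightarrow> real" and j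
    using that by (intro continuous_on_sequentiallyI seq) (auto simp: continuous_on_sequentially o_def)
  have int: "(\<lambda>s. F (y s) j) integrable_on {t1..t2}"
    if "\<And>k. continuous_on {0..} (\<lambda>s. y s k)" "0 \<le> t1" for y :: "real \<Rightarrow> int \<Rightarrow> real" and j t1 t2
    using that by (intro integrable_continuous_real continuous_on_subset[OF contF]) auto
  have incr: "Y (Suc n) t j - Y (Suc n) s j = integral {s..t} (\<lambda>s. F (Y n s) j)"
    if "\<And>k. continuous_on {0..} (\<lambda>s. Y n s k)" "0 \<le> s" "s \<le> t" for n s t j
    using Henstock_Kurzweil_Integration.integral_combine[OF that(2,3) int[of "Y n" 0 j t]] that by (simp add: YS)
  have intbound: "\<bar>integral {s..t} (\<lambda>s. F (y s) j)\<bar> \<le> B * (t - s)"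
    if "\<And>k. continuous_on {0..} (\<lambda>s. y s k)" "0 \<le> s" "s \<le> t" for y :: "real \<Rightarrow> int \<Rightarrow> real" and s t j
  proof -
    have "continuous_on {s..t} (\<lambda>s. F (y s) j)"
      by (rule continuous_on_subset[OF contF]) (use that in auto)
    then show ?thesis using integral_bound[of s t "\<lambda>s. F (y s) j" B] that bound by simp
  qed
  have Ycont: "continuous_on {0..} (\<lambda>t. Y n t j)" for n j
  proof (induction n arbitrary: j)
    case 0
    then show ?case by (simp add: Y0)
  next
    case (Suc n)
    then show ?case
      using intbound[OF Suc] incr[OF Suc] B by (intro continuous_on_half_line[of B]) auto
  qed
  have diff: "\<bar>Y (Suc n) t j - Y n t j\<bar> \<le> B * \<Lambda> ^ n * t ^ Suc n / fact (Suc n)" if "0 \<le> t" for n t j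
    using that
  proof (induction n arbitrary: t j)
    case 0
    then show ?case using intbound[of "Y 0" 0 t j] Ycont by (simp add: YS Y0)
  next
    case (Suc n)
    let ?c = "B * \<Lambda> ^ Suc n"
    have "((\<lambda>s. ?c * (s ^ Suc n / fact (Suc n))) has_integral (?c * (t ^ Suc (Suc n) / fact (Suc (Suc n))) - ?c * (0 ^ Suc (Suc n) / fact (Suc (Suc n))))) {0..t}"
    proof (rule fundamental_theorem_of_calculus[OF Suc.prems])
      fix s
      have "((\<lambda>s. ?c * (s ^ Suc (Suc n) / fact (Suc (Suc n)))) has_real_derivative
          ?c * (real (Suc (Suc n)) * s ^ Suc n / fact (Suc (Suc n)))) (at s within {0..t})"
        by (intro derivative_eq_intros refl | simp)+
      also have "real (Suc (Suc n)) * s ^ Suc n / fact (Suc (Suc n)) = s ^ Suc n / fact (Suc n)"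
        unfolding fact_Suc[of "Suc n"] of_nat_mult by (simp del: of_nat_Suc fact_Suc)
      finally show "((\<lambda>s. ?c * (s ^ Suc (Suc n) / fact (Suc (Suc n)))) has_vector_derivative ?c * (s ^ Suc n / fact (Suc n))) (at s within {0..t})"
        by (simp add: has_real_derivative_iff_has_vector_derivative)
    qed
    then have H: "((\<lambda>s. ?c * (s ^ Suc n / fact (Suc n))) has_integral (?c * (t ^ Suc (Suc n) / fact (Suc (Suc n))))) {0..t}"
      by simp
    have "\<bar>integral {0..t} (\<lambda>s. F (Y (Suc n) s) j - F (Y n s) j)\<bar> \<le> integral {0..t} (\<lambda>s. ?c * (s ^ Suc n / fact (Suc n)))"
      unfolding real_norm_def[symmetric]
    proof (rule integral_norm_bound_integral)
      show "(\<lambda>s. F (Y (Suc n) s) j - F (Y n s) j) integrable_on {0..t}"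
        by (intro integrable_diff int Ycont) auto
      show "(\<lambda>s. ?c * (s ^ Suc n / fact (Suc n))) integrable_on {0..t}" using H by blast
      fix s assume "s \<in> {0..t}"
      then have "\<bar>F (Y (Suc n) s) j - F (Y n s) j\<bar> \<le> \<Lambda> * (B * \<Lambda> ^ n * s ^ Suc n / fact (Suc n))"
        by (intro lip allI Suc.IH) auto
      then show "norm (F (Y (Suc n) s) j - F (Y n s) j) \<le> ?c * (s ^ Suc n / fact (Suc n))"
        by (simp add: mult.assoc mult.left_commute)
    qed
    also have "integral {0..t} (\<lambda>s. F (Y (Suc n) s) j - F (Y n s) j) = Y (Suc (Suc n)) t j - Y (Suc n) t j"
      unfolding YS[of "Suc n" t j] YS[of n t j] by (subst integral_diff) (auto intro!: int Ycont)
    also have "integral {0..t} (\<lambda>s. ?c * (s ^ Suc n / fact (Suc n))) = ?c * (t ^ Suc (Suc n) / fact (Suc (Suc n)))"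
      using H by (rule integral_unique)
    finally show ?case by (simp add: mult.assoc)
  qed
  have conv: "convergent (\<lambda>n. Y n t j)" if t: "0 \<le> t" for t j
  proof -
    have "summable (\<lambda>n. B * t * (inverse (fact n) * (\<Lambda> * t) ^ n))"
      by (intro summable_mult summable_exp)
    then have "summable (\<lambda>n. Y (Suc n) t j - Y n t j)"
    proof (rule summable_comparison_test'[where N = 0])
      fix n
      \<comment> \<open>Weakening the factorial matches the terms of the exponential series.\<close>
      have "B * \<Lambda> ^ n * t ^ Suc n / fact (Suc n) \<le> B * \<Lambda> ^ n * t ^ Suc n / fact n"
        using t L B by (intro divide_left_mono mult_nonneg_nonneg fact_mono) (auto simp del: fact_Suc)
      also have "B * \<Lambda> ^ n * t ^ Suc n / fact n = B * t * (inverse (fact n) * (\<Lambda> * t) ^ n)"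
        by (simp add: power_mult_distrib field_simps)
      finally show "norm (Y (Suc n) t j - Y n t j) \<le> B * t * (inverse (fact n) * (\<Lambda> * t) ^ n)"
        using diff[OF t, of n j] by simp
    qed
    then have "convergent (\<lambda>n. \<Sum>i<n. Y (Suc i) t j - Y i t j)"
      by (simp add: summable_iff_convergent)
    then have "convergent (\<lambda>n. Y n t j - y0 j)" 
      using sum_lessThan_telescope[of "\<lambda>n. Y n t j"] by (simp add: Y0)
    then show ?thesis using convergent_add[OF _ convergent_const[of "y0 j"]] by fastforce
  qed
  define y where "y t j = lim (\<lambda>n. Y n t j)" for t j
  have ylim: "(\<lambda>n. Y n t j) \<longlonglongrightarrow> y t j" if "0 \<le> t" for t j
    using conv[OF that] by (simp add: y_def convergent_LIMSEQ_iff)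
  have Flim: "(\<lambda>n. F (Y n s) j) \<longlonglongrightarrow> F (y s) j" if "0 \<le> s" for s j
    using that by (intro seq allI ylim)
  have integral: "((\<lambda>s. F (y s) j) has_integral (y t2 j - y t1 j)) {t1..t2}" if "0 \<le> t1" "t1 \<le> t2" for j t1 t2
  proof -
    have *: "(\<lambda>s. F (y s) j) integrable_on {t1..t2}"
      "(\<lambda>n. integral {t1..t2} (\<lambda>s. F (Y n s) j)) \<longlonglongrightarrow> integral {t1..t2} (\<lambda>s. F (y s) j)"
      by (rule dominated_convergence[where h = "\<lambda>s. B" and f = "\<lambda>n s. F (Y n s) j"];
          use that bound Ycont in \<open>auto intro!: int Flim\<close>)+
    have "(\<lambda>n. Y (Suc n) t2 j - Y (Suc n) t1 j) \<longlonglongrightarrow> y t2 j - y t1 j"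
      using that by (intro tendsto_diff LIMSEQ_Suc ylim) auto
    then have "(\<lambda>n. integral {t1..t2} (\<lambda>s. F (Y n s) j)) \<longlonglongrightarrow> y t2 j - y t1 j"
      using incr[OF Ycont that] by simp
    then have "integral {t1..t2} (\<lambda>s. F (y s) j) = y t2 j - y t1 j"
      using *(2) LIMSEQ_unique by blast
    then show ?thesis using *(1) by (metis integrable_integral)
  qed
  show thesis
  proof
    show "y 0 = y0"
    proof
      fix j
      have "Y n 0 j = y0 j" for n by (cases n) (simp_all add: Y0 YS)
      then show "y 0 j = y0 j" by (simp add: y_def)
    qed
    show "continuous_on {0..} (\<lambda>t. y t j)" for j
    proof (rule continuous_on_half_line[OF B])
      fix s t :: real assume st: "0 \<le> s" "s \<le> t"
      have "norm (y t j - y s j) \<le> B * measure lborel (cbox s t)"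
        using integral[OF st, of j] bound
        by (intro has_integral_bound[OF B, of "\<lambda>s. F (y s) j"]) auto
      then show "\<bar>y t j - y s j\<bar> \<le> B * (t - s)" using st by simp
    qed
  qed (rule integral)
qed

lemma shifted_powr_lipschitz:
  fixes a b :: real
  assumes "0 < \<beta>" "0 < \<epsilon>" "0 \<le> a" "0 \<le> b"
  shows "\<bar>(a + \<epsilon>) powr (- \<beta>) - (b + \<epsilon>) powr (- \<beta>)\<bar> \<le> \<beta> * \<epsilon> powr (- \<beta> - 1) * \<bar>a - b\<bar>"
proof -
  have le: "\<bar>(a + \<epsilon>) powr (- \<beta>) - (b + \<epsilon>) powr (- \<beta>)\<bar> \<le> \<beta> * \<epsilon> powr (- \<beta> - 1) * \<bar>a - b\<bar>"
    if ab: "0 \<le> a" "a < b" for a b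
  proof -
    have "\<exists>z>a. z < b \<and> (b + \<epsilon>) powr (- \<beta>) - (a + \<epsilon>) powr (- \<beta>) = (b - a) * (- \<beta> * (z + \<epsilon>) powr (- \<beta> - 1))"
      using ab assms(2) by (intro MVT2) (auto intro!: derivative_eq_intros)
    then obtain z where z: "a < z"
      "(b + \<epsilon>) powr (- \<beta>) - (a + \<epsilon>) powr (- \<beta>) = (b - a) * (- \<beta> * (z + \<epsilon>) powr (- \<beta> - 1))" by auto
    then have "\<bar>(a + \<epsilon>) powr (- \<beta>) - (b + \<epsilon>) powr (- \<beta>)\<bar> = \<beta> * (z + \<epsilon>) powr (- \<beta> - 1) * \<bar>a - b\<bar>"
      using ab assms(1) by (subst abs_minus_commute) (simp add: abs_mult)
    also have "\<dots> \<le> \<beta> * \<epsilon> powr (- \<beta> - 1) * \<bar>a - b\<bar>"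
      using ab z assms by (intro mult_right_mono mult_left_mono powr_mono2') auto
    finally show ?thesis .
  qed
  show ?thesis
  proof (cases a b rule: linorder_cases)
    case less
    then show ?thesis using le[of a b] assms by simp
  next
    case equal
    then show ?thesis by simp
  next
    case greater
    then show ?thesis using le[of b a] assms by (simp add: abs_minus_commute)
  qed
qed

section \<open>Finitely many particles\<close>

text \<open>Between two vanishing times the set \<open>A\<close> of positive particles is fixed and the system is a
  finite system of ordinary differential equations with Lipschitz right-hand side.\<close>
lemma fixed_alive_set_flow:
  assumes "0 < \<beta>" "0 < \<epsilon>" "\<And>j. j \<notin> A \<Longrightarrow> z j = 0"
  shows "\<exists>y. y 0 = z \<and> (\<forall>j. continuous_on {0..} (\<lambda>t. y t j)) \<and>
    (\<forall>j t1 t2. 0 \<le> t1 \<and> t1 \<le> t2 \<longrightarrow>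
      ((\<lambda>s. lap A (\<lambda>k. (max (y s k) 0 + \<epsilon>) powr (- \<beta>)) j) has_integral (y t2 j - y t1 j)) {t1..t2::real}) \<and>
    (\<forall>t j. 0 \<le> t \<and> j \<notin> A \<longrightarrow> y t j = 0)"
proof -
  \<comment> \<open>Cutting off at 0 makes the nonlinearity bounded and Lipschitz on the whole line,
    so the flow exists globally; it is used only while all particles of \<open>A\<close> are
    positive.\<close>
  define v where "v y k = (max (y k) 0 + \<epsilon>) powr (- \<beta>)" for y :: "int \<Rightarrow> real" and k
  define F where "F y j = lap A (v y) j" for y j
  define B where "B = \<epsilon> powr (- \<beta>)"
  define \<Lambda> where "\<Lambda> = \<beta> * \<epsilon> powr (- \<beta> - 1)"
  have v: "0 \<le> v y k" "v y k \<le> B" for y k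
    unfolding v_def B_def using assms by (auto intro!: powr_mono2')
  have vlip: "\<bar>v y k - v w k\<bar> \<le> \<Lambda> * e" if "\<forall>k. \<bar>y k - w k\<bar> \<le> e" for y w e k
  proof -
    have "\<bar>v y k - v w k\<bar> \<le> \<Lambda> * \<bar>max (y k) 0 - max (w k) 0\<bar>"
      unfolding v_def \<Lambda>_def using assms by (intro shifted_powr_lipschitz) auto
    also have "\<dots> \<le> \<Lambda> * e"
    proof (rule mult_left_mono)
      show "\<bar>max (y k) 0 - max (w k) 0\<bar> \<le> e" using that[rule_format, of k] by (auto simp: max_def)
    qed (use assms in \<open>simp add: \<Lambda>_def\<close>)
    finally show ?thesis .
  qed
  have vlim: "(\<lambda>n. v (u n) k) \<longlonglongrightarrow> v l k" if "\<forall>k. (\<lambda>n. u n k) \<longlonglongrightarrow> l k" for u l k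
    unfolding v_def using that assms by (intro tendsto_intros) (auto simp: max_def)
  have B: "0 \<le> B" by (simp add: B_def)
  have lr: "0 \<le> lft A (v y) j" "lft A (v y) j \<le> B" "0 \<le> rgt A (v y) j" "rgt A (v y) j \<le> B" for y j
    using lft_eq_or[of A j] rgt_eq_or[of A j] v[of y] B by auto
  have lrlim: "(\<lambda>n. lft A (v (u n)) j) \<longlonglongrightarrow> lft A (v l) j" "(\<lambda>n. rgt A (v (u n)) j) \<longlonglongrightarrow> rgt A (v l) j"
    if "\<forall>k. (\<lambda>n. u n k) \<longlonglongrightarrow> l k" for u l j
    using lft_eq_or[of A j] rgt_eq_or[of A j] vlim[OF that] by auto
  have lrlip: "\<bar>lft A (v y) j - lft A (v w) j\<bar> \<le> \<Lambda> * e" "\<bar>rgt A (v y) j - rgt A (v w) j\<bar> \<le> \<Lambda> * e"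
    if "\<forall>k. \<bar>y k - w k\<bar> \<le> e" for y w e j
  proof -
    have "0 \<le> \<Lambda> * e" using vlip[OF that, of 0] by linarith
    then show "\<bar>lft A (v y) j - lft A (v w) j\<bar> \<le> \<Lambda> * e" "\<bar>rgt A (v y) j - rgt A (v w) j\<bar> \<le> \<Lambda> * e"
      using lft_eq_or[of A j] rgt_eq_or[of A j] vlip[OF that] by auto
  qed
  obtain y where y: "y 0 = z" "\<And>j. continuous_on {0..} (\<lambda>t. y t j)"
    "\<And>j t1 t2. 0 \<le> t1 \<Longrightarrow> t1 \<le> t2 \<Longrightarrow> ((\<lambda>s. F (y s) j) has_integral (y t2 j - y t1 j)) {t1..t2::real}"
  proof (rule picard[of "4 * \<Lambda>" "4 * B" F z])
    show "\<bar>F y j\<bar> \<le> 4 * B" for y j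
      unfolding F_def lap_def using lr[of y "j - 1"] lr[of y j] lr[of y "j + 1"] by linarith
    show "\<bar>F y j - F w j\<bar> \<le> 4 * \<Lambda> * e" if "\<forall>k. \<bar>y k - w k\<bar> \<le> e" for y w e j
      unfolding F_def lap_def
      using lrlip(1)[OF that, of "j - 1"] lrlip(1)[OF that, of j] lrlip(2)[OF that, of "j + 1"] lrlip(2)[OF that, of j]
      by linarith
    show "(\<lambda>n. F (u n) j) \<longlonglongrightarrow> F l j" if "\<forall>k. (\<lambda>n. u n k) \<longlonglongrightarrow> l k" for u l j
      unfolding F_def lap_def by (intro tendsto_intros lrlim that)
  qed (use B assms in \<open>auto simp: \<Lambda>_def\<close>)
  have "y t j = 0" if "0 \<le> t" "j \<notin> A" for t j
  proof -
    have "((\<lambda>s. F (y s) j) has_integral 0) {0..t}"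
      by (rule has_integral_is_0) (simp add: F_def lap_notmem that)
    then have "y t j - y 0 j = 0"
      using y(3)[of 0 t j] that by (intro has_integral_unique[of "\<lambda>s. F (y s) j"]) auto
    then show ?thesis using y(1) assms that by simp
  qed
  then show ?thesis
    using y(1,2) y(3)[unfolded F_def v_def[abs_def]] by (intro exI[of _ y]) simp
qed

text \<open>The flow with fixed living set \<open>A\<close> solves the system until the first time
  \<open>\<tau>\<close> at which a particle of \<open>A\<close> reaches 0. From there a solution for
  the strictly smaller set of survivors is attached; several particles may die at
  \<open>\<tau>\<close> together, hence the induction over proper subsets.\<close>

lemma finite_coarsening_exists:
  assumes "0 < \<beta>" "0 < \<epsilon>" "finite A" "\<And>j. j \<in> A \<Longrightarrow> 0 < z j" "\<And>j. j \<notin> A \<Longrightarrow> z j = 0"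
  shows "\<exists>x. coarsening \<beta> \<epsilon> x \<and> x 0 = z"
  using assms(3-)
proof (induction A arbitrary: z rule: finite_psubset_induct)
  case (psubset A)
  obtain y where y: "y 0 = z" "\<And>j. continuous_on {0..} (\<lambda>t. y t j)"
    "\<And>j t1 t2. 0 \<le> t1 \<Longrightarrow> t1 \<le> t2 \<Longrightarrow>
      ((\<lambda>s. lap A (\<lambda>k. (max (y s k) 0 + \<epsilon>) powr (- \<beta>)) j) has_integral (y t2 j - y t1 j)) {t1..t2::real}"
    "\<And>t j. 0 \<le> t \<Longrightarrow> j \<notin> A \<Longrightarrow> y t j = 0"
    using fixed_alive_set_flow[OF assms(1,2), of A z] psubset.prems(2) by blast
  have lapy: "lap A (\<lambda>k. (max (y s k) 0 + \<epsilon>) powr (- \<beta>)) = lapg \<beta> \<epsilon> (y s)"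
    if "0 \<le> s" "\<forall>j\<in>A. 0 < y s j" for s
  proof -
    have "{k. 0 < y s k} = A" using that y(4)[of s] by force
    moreover have "max (y s k) 0 = y s k" for k using that y(4)[of s k] by (cases "k \<in> A") auto
    ultimately show ?thesis by (simp add: lapg_def)
  qed
  define B where "B = (\<Union>j\<in>A. {0..} \<inter> (\<lambda>t. y t j) -` {..0})"
  have closed: "closed B"
    unfolding B_def using psubset.hyps y(2)
    by (intro closed_UN ballI continuous_closed_preimage) auto
  have notB: "\<forall>j\<in>A. 0 < y s j" if "0 \<le> s" "s \<notin> B" for s
    using that by (force simp: B_def)
  show ?case
  proof (cases "B = {}")
    case True
    then have pos: "\<forall>j\<in>A. 0 < y s j" if "0 \<le> s" for s using notB that by auto
    have "coarsening \<beta> \<epsilon> y"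
    proof
      show "0 \<le> y t j" if "0 \<le> t" for t j using pos[OF that] y(4)[OF that] by (cases "j \<in> A") auto
      show "y t j = 0" if "0 \<le> s" "s \<le> t" "y s j = 0" for s t j
        using pos[OF that(1)] y(4)[of t j] that by fastforce
      show "((\<lambda>s. lapg \<beta> \<epsilon> (y s) j) has_integral (y t2 j - y t1 j)) {t1..t2}" if "0 \<le> t1" "t1 \<le> t2" for t1 t2 j
        by (rule has_integral_eq[OF _ y(3)[OF that]]) (use that pos lapy in auto)
    qed (use assms y in auto)
    then show ?thesis using y(1) by auto
  next
    case False
    define \<tau> where "\<tau> = Inf B"
    have bd: "bdd_below B" by (auto simp: B_def bdd_below_def)
    have \<tau>B: "\<tau> \<in> B" unfolding \<tau>_def using closed_contains_Inf[OF False bd closed] .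
    have \<tau>0: "0 < \<tau>"
    proof -
      have "0 \<notin> B" using psubset.prems(1) y(1) by (force simp: B_def)
      then show ?thesis using \<tau>B by (cases "\<tau> = 0") (auto simp: B_def)
    qed
    have pos: "\<forall>j\<in>A. 0 < y s j" if "0 \<le> s" "s < \<tau>" for s
      using notB[OF that(1)] cInf_lower[OF _ bd, of s] that by (force simp: \<tau>_def)
    have \<tau>ge: "0 \<le> y \<tau> j" for j
    proof (rule ccontr)
      assume neg: "\<not> 0 \<le> y \<tau> j"
      then have jA: "j \<in> A" using y(4)[of \<tau> j] \<tau>0 by force
      have "\<exists>s\<ge>0. s \<le> \<tau> \<and> y s j = 0"
      proof (rule IVT2')
        show "continuous_on {0..\<tau>} (\<lambda>t. y t j)" by (rule continuous_on_subset[OF y(2)]) auto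
      qed (use neg \<tau>0 y(1) psubset.prems(1)[OF jA] in auto)
      then obtain s where s: "0 \<le> s" "s \<le> \<tau>" "y s j = 0" by auto
      then have "s < \<tau>" using neg by (cases "s = \<tau>") auto
      then show False using pos[of s] s jA by auto
    qed
    define A' where "A' = {j \<in> A. 0 < y \<tau> j}"
    have "A' \<subset> A" using \<tau>B by (force simp: A'_def B_def)
    moreover have "0 < y \<tau> j" if "j \<in> A'" for j using that by (simp add: A'_def)
    moreover have "y \<tau> j = 0" if "j \<notin> A'" for j
      using that \<tau>ge[of j] y(4)[of \<tau> j] \<tau>0 by (cases "j \<in> A") (auto simp: A'_def)
    ultimately obtain w where w: "coarsening \<beta> \<epsilon> w" "w 0 = y \<tau>" using psubset.IH[of A' "y \<tau>"] by auto
    interpret w: coarsening \<beta> \<epsilon> w by (rule w(1))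
    define x where "x t = (if t < \<tau> then y t else w (t - \<tau>))" for t
    have xy: "x t = y t" if "t \<le> \<tau>" for t using that w(2) by (auto simp: x_def)
    have xw: "x t = w (t - \<tau>)" if "\<tau> \<le> t" for t using that by (simp add: x_def)
    have int1: "((\<lambda>s. lapg \<beta> \<epsilon> (x s) j) has_integral (x t2 j - x t1 j)) {t1..t2}"
      if "0 \<le> t1" "t1 \<le> t2" "t2 \<le> \<tau>" for t1 t2 j
    proof -
      have "((\<lambda>s. lapg \<beta> \<epsilon> (x s) j) has_integral (y t2 j - y t1 j)) {t1..t2}"
      proof (rule has_integral_spike_finite[OF _ _ y(3)[OF that(1,2)], of "{\<tau>}"])
        show "lapg \<beta> \<epsilon> (x s) j = lap A (\<lambda>k. (max (y s k) 0 + \<epsilon>) powr (- \<beta>)) j" if "s \<in> {t1..t2} - {\<tau>}" for s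
          using lapy[of s] pos[of s] xy[of s] that \<open>0 \<le> t1\<close> \<open>t2 \<le> \<tau>\<close> by auto
      qed auto
      then show ?thesis using that xy by simp
    qed
    have int2: "((\<lambda>s. lapg \<beta> \<epsilon> (x s) j) has_integral (x t2 j - x t1 j)) {t1..t2}"
      if "\<tau> \<le> t1" "t1 \<le> t2" for t1 t2 j
    proof -
      have "((\<lambda>s. lapg \<beta> \<epsilon> (w (s + (- \<tau>))) j) has_integral (w (t2 - \<tau>) j - w (t1 - \<tau>) j))
          {t1 - \<tau> - (- \<tau>)..t2 - \<tau> - (- \<tau>)}"
        using that by (intro has_integral_shift_real_ivl w.eqn) auto
      then have "((\<lambda>s. lapg \<beta> \<epsilon> (w (s - \<tau>)) j) has_integral (x t2 j - x t1 j)) {t1..t2}"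
        using that xw by simp
      then show ?thesis by (rule has_integral_eq[rotated]) (use that xw in auto)
    qed
    have "coarsening \<beta> \<epsilon> x"
    proof
      show "0 \<le> x t j" if "0 \<le> t" for t j
        using that pos[of t] y(4)[of t j] w.nonneg[of "t - \<tau>" j]
        by (cases "j \<in> A") (auto simp: x_def not_less less_imp_le)
      show "x t j = 0" if st: "0 \<le> s" "s \<le> t" "x s j = 0" for s t j
      proof (cases "s < \<tau>")
        case True
        then have "j \<notin> A" using pos[of s] st by (auto simp: x_def)
        then have "y r j = 0" if "0 \<le> r" for r using y(4) that by simp
        moreover have "w (t - \<tau>) j = 0" if "\<tau> \<le> t"
          using w.dead[of 0 "t - \<tau>" j] w(2) calculation[of \<tau>] \<tau>0 that by auto
        ultimately show ?thesis using st by (simp add: x_def)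
      next
        case False
        then show ?thesis using st w.dead[of "s - \<tau>" "t - \<tau>" j] by (auto simp: x_def)
      qed
      show "continuous_on {0..} (\<lambda>t. x t j)" for j
      proof -
        have "continuous_on {0..\<tau>} (\<lambda>t. x t j)"
          using continuous_on_subset[OF y(2)[of j], of "{0..\<tau>}"] xy
          by (subst continuous_on_cong[OF refl, where g = "\<lambda>t. y t j"]) auto
        moreover have "continuous_on {\<tau>..} (\<lambda>t. w (t - \<tau>) j)"
          by (rule continuous_on_compose2[OF w.cont]) (auto intro!: continuous_intros)
        then have "continuous_on {\<tau>..} (\<lambda>t. x t j)"
          using xw by (subst continuous_on_cong[OF refl, where g = "\<lambda>t. w (t - \<tau>) j"]) auto
        ultimately have "continuous_on ({0..\<tau>} \<union> {\<tau>..}) (\<lambda>t. x t j)"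
          by (intro continuous_on_closed_Un) auto
        moreover have "{0..\<tau>} \<union> {\<tau>..} = {0..}" using \<tau>0 by auto
        ultimately show ?thesis by simp
      qed
      show "((\<lambda>s. lapg \<beta> \<epsilon> (x s) j) has_integral (x t2 j - x t1 j)) {t1..t2}" if t: "0 \<le> t1" "t1 \<le> t2" for t1 t2 j
      proof -
        consider "t2 \<le> \<tau>" | "\<tau> \<le> t1" | "t1 < \<tau>" "\<tau> < t2" by linarith
        then show ?thesis
        proof cases
          case 3
          then have "((\<lambda>s. lapg \<beta> \<epsilon> (x s) j) has_integral ((x \<tau> j - x t1 j) + (x t2 j - x \<tau> j))) {t1..t2}"
            using t by (intro has_integral_combine[where c = \<tau>] int1 int2) auto
          then show ?thesis by simp
        qed (use t int1 int2 in auto)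
      qed
    qed (use assms in auto)
    moreover have "x 0 = z" using \<tau>0 y(1) by (simp add: x_def)
    ultimately show ?thesis by auto
  qed
qed

section \<open>Compactness of approximations\<close>

text \<open>Convergence of the sizes does not suffice: a site that is dead in the limit must be dead
  along the sequence eventually, otherwise it would remain a neighbour. The living sites
  \<open>p\<close> and \<open>q\<close> confine the matter to finitely many sites. The lemma is used
  for the approximations and, with vanishing shift, for continuity in time of the limiting
  right-hand side.\<close>

lemma lapg_tendsto:
  assumes e: "e \<longlonglongrightarrow> 0" and pq: "p \<le> j - 1" "0 < z p" "j + 1 \<le> q" "0 < z q"
    and lim: "\<And>k. p \<le> k \<Longrightarrow> k \<le> q \<Longrightarrow> (\<lambda>n. Z n k) \<longlonglongrightarrow> z k"
    and dead: "\<And>k. p \<le> k \<Longrightarrow> k \<le> q \<Longrightarrow> \<not> 0 < z k \<Longrightarrow> \<forall>\<^sub>F n in sequentially. Z n k = 0"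
  shows "(\<lambda>n. lapg \<beta> (e n) (Z n) j) \<longlonglongrightarrow> lapg \<beta> 0 z j"
proof -
  let ?A = "{k. 0 < z k}" and ?v = "\<lambda>n k. (Z n k + e n) powr (- \<beta>)"
  have vlim: "(\<lambda>n. ?v n k) \<longlonglongrightarrow> (z k + 0) powr (- \<beta>)" if "p \<le> k" "k \<le> q" "0 < z k" for k
    using that by (intro tendsto_powr tendsto_add lim e tendsto_const) auto
  have "\<forall>\<^sub>F n in sequentially. \<forall>k\<in>{p..q}. 0 < Z n k \<longleftrightarrow> 0 < z k"
  proof (rule eventually_ball_finite)
    show "\<forall>k\<in>{p..q}. \<forall>\<^sub>F n in sequentially. 0 < Z n k \<longleftrightarrow> 0 < z k"
    proof
      fix k assume k: "k \<in> {p..q}"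
      show "\<forall>\<^sub>F n in sequentially. 0 < Z n k \<longleftrightarrow> 0 < z k"
      proof (cases "0 < z k")
        case True
        then show ?thesis using order_tendstoD(1)[OF lim True] k by (auto elim: eventually_mono)
      next
        case False
        then show ?thesis using dead[OF _ _ False] k by (auto elim: eventually_mono)
      qed
    qed
  qed simp
  then have "\<forall>\<^sub>F n in sequentially. lapg \<beta> (e n) (Z n) j = lap ?A (?v n) j"
  proof eventually_elim
    case (elim n)
    let ?B = "{k. 0 < Z n k}"
    show ?case
    proof (cases "0 < z j")
      case True
      have "lft ?A (?v n) (j - 1) = lft ?B (?v n) (j - 1)"
        by (rule lft_cong[of p]) (use elim pq in auto)
      moreover have "rgt ?A (?v n) (j + 1) = rgt ?B (?v n) (j + 1)"
        by (rule rgt_cong[of q]) (use elim pq in auto)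
      ultimately show ?thesis using True elim pq by (simp add: lapg_def lap_mem)
    next
      case False
      then show ?thesis using elim pq by (simp add: lapg_def lap_notmem)
    qed
  qed
  moreover have "(\<lambda>n. lap ?A (?v n) j) \<longlonglongrightarrow> lapg \<beta> 0 z j"
  proof (cases "0 < z j")
    case True
    obtain k where k: "k \<in> ?A" "p \<le> k" "k \<le> j - 1" "\<And>v. lft ?A v (j - 1) = v k"
      using lft_cases[of p ?A "j - 1"] pq by auto
    obtain l where l: "l \<in> ?A" "j + 1 \<le> l" "l \<le> q" "\<And>v. rgt ?A v (j + 1) = v l"
      using rgt_cases[of q ?A "j + 1"] pq by auto
    have "(\<lambda>n. ?v n k - 2 * ?v n j + ?v n l) \<longlonglongrightarrow>
        (z k + 0) powr (- \<beta>) - 2 * (z j + 0) powr (- \<beta>) + (z l + 0) powr (- \<beta>)"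
      using k l pq True by (intro tendsto_add tendsto_diff tendsto_mult tendsto_const vlim) auto
    then show ?thesis using True by (simp add: lapg_def lap_mem k(4) l(4))
  next
    case False
    then show ?thesis by (simp add: lapg_def lap_notmem)
  qed
  ultimately show ?thesis by (simp add: tendsto_cong)
qed

lemma hoelder_imp_continuous:
  fixes f C :: "real \<Rightarrow> real"
  assumes "0 < \<alpha>"
    "\<And>T t1 t2. 0 < T \<Longrightarrow> 0 \<le> t1 \<Longrightarrow> t1 \<le> t2 \<Longrightarrow> t2 \<le> T \<Longrightarrow> \<bar>f t2 - f t1\<bar> \<le> C T * (t2 - t1) powr \<alpha>"
  shows "continuous_on {0..} f"
proof (rule continuous_on_sequentiallyI)
  fix u a assume u: "\<forall>n. u n \<in> {0::real..}" "a \<in> {0..}" "u \<longlonglongrightarrow> a"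
  have "(\<lambda>n. f (u n) - f a) \<longlonglongrightarrow> 0"
  proof (rule Lim_null_comparison)
    have "\<forall>\<^sub>F n in sequentially. u n < a + 1" using order_tendstoD(2)[OF u(3)] by simp
    then show "\<forall>\<^sub>F n in sequentially. norm (f (u n) - f a) \<le> C (a + 1) * \<bar>u n - a\<bar> powr \<alpha>"
    proof eventually_elim
      case (elim n)
      then show ?case
        using assms(2)[of "a + 1" "u n" a] assms(2)[of "a + 1" a "u n"] u(1)[rule_format, of n] u(2)
        by (cases "u n \<le> a") (auto simp: abs_minus_commute)
    qed
    have "(\<lambda>n. \<bar>u n - a\<bar>) \<longlonglongrightarrow> 0"
      using u(3) by (simp add: LIM_zero_iff tendsto_rabs_zero_iff)
    then have "(\<lambda>n. \<bar>u n - a\<bar> powr \<alpha>) \<longlonglongrightarrow> 0"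
      using assms(1) by (intro tendsto_zero_powrI) auto
    then show "(\<lambda>n. C (a + 1) * \<bar>u n - a\<bar> powr \<alpha>) \<longlonglongrightarrow> 0"
      by (rule tendsto_mult_right_zero)
  qed
  then show "(\<lambda>n. f (u n)) \<longlonglongrightarrow> f a" by (simp add: LIM_zero_iff)
qed

text \<open>\<open>r n\<close> is the half-width of the range on which the \<open>n\<close>-th
  system obeys the bounds. As a parameter it lets the same locale describe the full sequence and any
  subsequence.\<close>

locale approximation =
  fixes \<beta> D :: real and N :: "real \<Rightarrow> int" and K C :: "real \<Rightarrow> real" and e :: "nat \<Rightarrow> real"
    and Z :: "nat \<Rightarrow> real \<Rightarrow> int \<Rightarrow> real" and r :: "nat \<Rightarrow> nat"
  assumes beta: "0 < \<beta>" and D: "0 < D" and NKC: "0 < T \<Longrightarrow> 0 < N T \<and> 0 < K T \<and> 0 \<le> C T"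
    and e: "e \<longlonglongrightarrow> 0" and r: "strict_mono r"
    and coarse: "coarsening \<beta> (e n) (Z n)"
    and bounds: "0 < T \<Longrightarrow> apriori_bounds \<beta> D T (N T) (K T) (C T) (e n) (Z n) (- int (r n)) (int (r n))"
begin

abbreviation \<alpha> :: real where "\<alpha> \<equiv> 1 / (\<beta> + 1)"

lemma alpha: "0 < \<alpha>" using beta by simp

lemma eventually_range: "\<forall>\<^sub>F n in sequentially. b \<le> int (r n)"
proof -
  have "b \<le> int (r n)" if "nat b \<le> n" for n
    using seq_suble[OF r, of n] that by linarith
  then show ?thesis unfolding eventually_sequentially by blast
qed

text \<open>A fixed site has the required margin to both ends of the range once \<open>n\<close> is
  large.\<close>

lemma eventually_hoelder:
  "0 < T \<Longrightarrow> \<forall>\<^sub>F n in sequentially. \<forall>t1 t2. 0 \<le> t1 \<longrightarrow> t1 \<le> t2 \<longrightarrow> t2 \<le> T \<longrightarrow>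
     \<bar>Z n t2 j - Z n t1 j\<bar> \<le> C T * (t2 - t1) powr \<alpha>"
  using eventually_range[of "\<bar>j\<bar> + 2 * N T"]
proof eventually_elim
  case (elim n)
  then have "- int (r n) + 2 * N T \<le> j" "j + 2 * N T \<le> int (r n)" by auto
  then show ?case using bounds[OF elim(1), of n] unfolding apriori_bounds_def by blast
qed

lemma eventually_lower:
  "0 < T \<Longrightarrow> \<forall>\<^sub>F n in sequentially. \<forall>t s. 0 \<le> t \<longrightarrow> t \<le> s \<longrightarrow> s \<le> T \<longrightarrow> 0 < Z n s j \<longrightarrow>
     K T * (s - t) \<le> (Z n t j + e n) powr (\<beta> + 1)"
  using eventually_range[of "\<bar>j\<bar> + N T"]
proof eventually_elim
  case (elim n)
  then have "- int (r n) + N T \<le> j" "j + N T \<le> int (r n)" by auto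
  then show ?case using bounds[OF elim(1), of n] unfolding apriori_bounds_def by blast
qed

lemma eventually_anchor:
  "0 < T \<Longrightarrow> \<forall>\<^sub>F n in sequentially. \<forall>t. 0 \<le> t \<longrightarrow> t \<le> T \<longrightarrow> (\<exists>p\<in>{a..a + N T - 1}. D / 2 \<le> Z n t p)"
  using eventually_range[of "\<bar>a\<bar> + N T"]
proof eventually_elim
  case (elim n)
  then have "- int (r n) \<le> a" "a + N T \<le> int (r n) + 1" using NKC[OF elim(1)] by auto
  then show ?case using bounds[OF elim(1), of n] unfolding apriori_bounds_def anchored_def by auto
qed

text \<open>An Arzela-Ascoli argument: a diagonal sequence converges at every site and every
  nonnegative rational time, and the uniform Hoelder bound extends this to real times.\<close>

lemma convergent_subsequence:
  assumes init: "\<And>j. convergent (\<lambda>n. Z n 0 j)"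
  obtains d where "strict_mono d" "\<And>t j. 0 \<le> t \<Longrightarrow> convergent (\<lambda>n. Z (d n) t j)"
proof -
  have bdd: "bounded (range (\<lambda>n. Z n t j))" if t: "0 \<le> t" for t j
  proof -
    obtain b where b: "\<bar>Z n 0 j\<bar> \<le> b" for n
      using convergent_imp_Bseq[OF init[of j]] unfolding Bseq_def real_norm_def by blast
    have t1: "0 < t + 1" using t by simp
    have "\<forall>\<^sub>F n in sequentially. norm (Z n t j) \<le> b + C (t + 1) * (t - 0) powr \<alpha>"
      using eventually_hoelder[OF t1, of j]
    proof eventually_elim
      case elim: (elim n)
      then show ?case using t b[of n] elim[rule_format, of 0 t] by auto
    qed
    then have "Bseq (\<lambda>n. Z n t j)" by (rule BfunI)
    then show ?thesis by (simp add: Bseq_eq_bounded)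
  qed
  \<comment> \<open>\<open>from_nat\<close> enumerates all pairs of a site and a rational; the
    absolute value turns the rational into an admissible time.\<close>
  define J where "J n = fst (from_nat n :: int \<times> rat)" for n
  define q where "q n = \<bar>real_of_rat (snd (from_nat n :: int \<times> rat))\<bar>" for n
  let ?P = "\<lambda>n s. convergent (\<lambda>k. Z (s k) (q n) (J n))"
  interpret diag: subseqs ?P
  proof
    fix n and s :: "nat \<Rightarrow> nat" assume "strict_mono s"
    have "bounded (range (\<lambda>k. Z (s k) (q n) (J n)))"
      by (rule bounded_subset[OF bdd[of "q n" "J n"]]) (auto simp: q_def)
    then obtain l r' where "strict_mono r'" "((\<lambda>k. Z (s k) (q n) (J n)) \<circ> r') \<longlonglongrightarrow> l"
      using bounded_imp_convergent_subsequence by blast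
    then show "\<exists>r'. strict_mono r' \<and> ?P n (s \<circ> r')"
      by (auto simp: convergent_def o_def)
  qed
  have shifted: "?P n (diag.diagseq \<circ> ((+) (Suc n)))" for n
    by (rule diag.diagseq_holds) (auto simp: o_def dest: convergent_subseq_convergent)
  have conv: "?P n diag.diagseq" for n
    using shifted[of n] convergent_ignore_initial_segment[of "\<lambda>k. Z (diag.diagseq k) (q n) (J n)" "Suc n"]
    by (simp add: o_def add.commute[of n])
  define d where "d = diag.diagseq"
  have rat: "convergent (\<lambda>k. Z (d k) \<bar>real_of_rat s\<bar> j)" for s j
  proof -
    have "J (to_nat (j, s)) = j" "q (to_nat (j, s)) = \<bar>real_of_rat s\<bar>" by (simp_all add: J_def q_def)
    then show ?thesis using conv[of "to_nat (j, s)"] unfolding d_def by simp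
  qed
  have mono: "strict_mono d" unfolding d_def by (rule diag.subseq_diagseq)
  have "Cauchy (\<lambda>k. Z (d k) t j)" if t: "0 \<le> t" for t j
  proof (rule metric_CauchyI)
    fix \<eta> :: real assume \<eta>: "0 < \<eta>"
    define c where "c = C (t + 1) + 1"
    have c: "0 < c" "C (t + 1) \<le> c" using NKC[of "t + 1"] t by (auto simp: c_def)
    \<comment> \<open>Within distance \<open>\<rho>\<close> the oscillation is at most
      \<open>\<eta> / 4\<close>; the bound 1 keeps the rational time below \<open>t + 1\<close>,
      where the constant \<open>C (t + 1)\<close> applies.\<close>
    define \<rho> where "\<rho> = min 1 ((\<eta> / (4 * c)) powr (1 / \<alpha>))"
    have \<rho>: "0 < \<rho>" using \<eta> c by (simp add: \<rho>_def)
    obtain s where s: "t < real_of_rat s" "real_of_rat s < t + \<rho>"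
      using of_rat_dense[of t "t + \<rho>"] \<rho> by auto
    then have sa: "\<bar>real_of_rat s\<bar> = real_of_rat s" using t by (intro abs_of_pos) linarith
    have "(real_of_rat s - t) powr \<alpha> \<le> ((\<eta> / (4 * c)) powr (1 / \<alpha>)) powr \<alpha>"
      using s alpha by (intro powr_mono2) (auto simp: \<rho>_def)
    also have "\<dots> = \<eta> / (4 * c)" using \<eta> c beta by (simp add: powr_powr)
    finally have "c * (real_of_rat s - t) powr \<alpha> \<le> c * (\<eta> / (4 * c))" using c by (intro mult_left_mono) auto
    moreover have "c * (\<eta> / (4 * c)) = \<eta> / 4" using c by simp
    moreover have "C (t + 1) * (real_of_rat s - t) powr \<alpha> \<le> c * (real_of_rat s - t) powr \<alpha>"
      using c by (intro mult_right_mono) auto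
    ultimately have small: "C (t + 1) * (real_of_rat s - t) powr \<alpha> \<le> \<eta> / 4" by linarith
    obtain n1 where n1: "\<And>n. n \<ge> n1 \<Longrightarrow> \<bar>Z n (real_of_rat s) j - Z n t j\<bar> \<le> \<eta> / 4"
      using eventually_hoelder[of "t + 1" j] small s t \<rho>_def
      unfolding eventually_sequentially by (smt (verit, best) min.cobounded1)
    obtain n2 where n2: "\<And>m n. m \<ge> n2 \<Longrightarrow> n \<ge> n2 \<Longrightarrow>
        \<bar>Z (d m) (real_of_rat s) j - Z (d n) (real_of_rat s) j\<bar> < \<eta> / 4"
      using convergent_Cauchy[OF rat[of s j]] \<eta> unfolding sa Cauchy_def dist_real_def
      by (metis zero_less_divide_iff zero_less_numeral)
    show "\<exists>M. \<forall>m\<ge>M. \<forall>n\<ge>M. dist (Z (d m) t j) (Z (d n) t j) < \<eta>"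
    proof (intro exI[of _ "max n1 n2"] allI impI)
      fix m n assume "max n1 n2 \<le> m" "max n1 n2 \<le> n"
      then have "n1 \<le> d m" "n1 \<le> d n" "n2 \<le> m" "n2 \<le> n"
        using seq_suble[OF mono, of m] seq_suble[OF mono, of n] by auto
      then show "dist (Z (d m) t j) (Z (d n) t j) < \<eta>"
        using n1[of "d m"] n1[of "d n"] n2[of m n] \<eta>
        unfolding dist_real_def by linarith
    qed
  qed
  then have "convergent (\<lambda>k. Z (d k) t j)" if "0 \<le> t" for t j
    using that by (simp add: Cauchy_convergent)
  then show thesis using that mono by blast
qed

end

section \<open>The limit equation\<close>

locale approximation_limit = approximation +
  fixes x :: "real \<Rightarrow> int \<Rightarrow> real"
  assumes lim: "0 \<le> t \<Longrightarrow> (\<lambda>n. Z n t j) \<longlonglongrightarrow> x t j"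
begin

lemma limit_nonneg: "0 \<le> t \<Longrightarrow> 0 \<le> x t j"
  by (rule LIMSEQ_le_const[OF lim]) (auto intro: coarsening.nonneg[OF coarse])

lemma limit_hoelder:
  assumes "0 < T" "0 \<le> t1" "t1 \<le> t2" "t2 \<le> T"
  shows "\<bar>x t2 j - x t1 j\<bar> \<le> C T * (t2 - t1) powr \<alpha>"
proof (rule tendsto_upperbound)
  show "(\<lambda>n. \<bar>Z n t2 j - Z n t1 j\<bar>) \<longlonglongrightarrow> \<bar>x t2 j - x t1 j\<bar>"
    using assms by (intro tendsto_rabs tendsto_diff lim) auto
  show "\<forall>\<^sub>F n in sequentially. \<bar>Z n t2 j - Z n t1 j\<bar> \<le> C T * (t2 - t1) powr \<alpha>"
    using eventually_hoelder[OF assms(1), of j] by eventually_elim (use assms in blast)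
qed simp

lemma limit_continuous: "continuous_on {0..} (\<lambda>t. x t j)"
  using limit_hoelder by (intro hoelder_imp_continuous[OF alpha, where C = C]) auto

text \<open>Survival of the \<open>n\<close>-th particle until \<open>s\<close> would require
  \<open>K s * (s - t) \<le> (Z n t j + e n) powr (\<beta> + 1)\<close>, but the right-hand side
  tends to 0.\<close>

lemma limit_dead_eventually:
  assumes "0 \<le> t" "t < s" "x t j = 0"
  shows "\<forall>\<^sub>F n in sequentially. Z n s j = 0"
proof -
  have s: "0 < s" using assms by simp
  have "(\<lambda>n. (Z n t j + e n) powr (\<beta> + 1)) \<longlonglongrightarrow> 0"
  proof (rule tendsto_zero_powrI[where b = "\<beta> + 1"])
    show "(\<lambda>n. Z n t j + e n) \<longlonglongrightarrow> 0"
      using tendsto_add[OF lim[OF assms(1), of j] e] assms(3) by simp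
    show "\<forall>\<^sub>F n in sequentially. 0 \<le> Z n t j + e n"
      using coarsening.nonneg[OF coarse assms(1)] coarsening.eps[OF coarse] by (simp add: add_nonneg_nonneg)
  qed (use beta in auto)
  moreover have "0 < K s * (s - t)" using NKC[OF s] assms by simp
  ultimately have "\<forall>\<^sub>F n in sequentially. (Z n t j + e n) powr (\<beta> + 1) < K s * (s - t)"
    by (rule order_tendstoD(2))
  then show ?thesis using eventually_lower[OF s, of j]
  proof eventually_elim
    case (elim n)
    then have "\<not> 0 < Z n s j" using elim(2)[rule_format, of t s] assms by linarith
    then show ?case using coarsening.nonneg[OF coarse, of s n j] s by simp
  qed
qed

lemma limit_dead:
  assumes "0 \<le> s" "s \<le> t" "x s j = 0"
  shows "x t j = 0"
proof (cases "s = t")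
  case False
  then have "\<forall>\<^sub>F n in sequentially. Z n t j = 0" using assms by (intro limit_dead_eventually[of s]) auto
  then show ?thesis using lim[of t j] assms by (metis LIMSEQ_unique order_trans tendsto_eventually)
qed (use assms in auto)

lemma limit_anchor:
  assumes "0 < T" "0 \<le> t" "t \<le> T"
  shows "\<exists>p\<in>{a..a + N T - 1}. D / 2 \<le> x t p"
proof (rule ccontr)
  assume "\<not> ?thesis"
  then have "\<forall>\<^sub>F n in sequentially. \<forall>p\<in>{a..a + N T - 1}. Z n t p < D / 2"
    using assms by (intro eventually_ball_finite ballI order_tendstoD(2)[OF lim]) (auto simp: not_le)
  then have "\<forall>\<^sub>F n in sequentially. False" using eventually_anchor[OF assms(1), of a]
    by eventually_elim (use assms in force)
  then show False by simp
qed

text \<open>The hypothesis \<open>reg\<close> says that \<open>u\<close> is not the vanishing time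
  of \<open>k\<close>. A particle alive at \<open>u\<close> stays bounded below nearby by the
  Hoelder estimate; one that died earlier is dead nearby, also in the approximations. Stating this
  for all small \<open>\<rho>\<close> allows a common \<open>\<rho>\<close> for finitely many
  sites.\<close>

lemma locally_dead_or_bounded_below:
  assumes u: "0 < u" and reg: "0 < x u k \<or> (\<exists>s. 0 \<le> s \<and> s < u \<and> x s k = 0)"
  shows "\<forall>\<^sub>F \<rho> in at_right 0. \<exists>\<delta>>0.
     ((\<forall>s\<in>{u-\<rho>..u+\<rho>}. x s k = 0) \<and> (\<forall>\<^sub>F n in sequentially. \<forall>s\<in>{u-\<rho>..u+\<rho>}. Z n s k = 0)) \<or>
     ((\<forall>s\<in>{u-\<rho>..u+\<rho>}. \<delta> \<le> x s k) \<and> (\<forall>\<^sub>F n in sequentially. \<forall>s\<in>{u-\<rho>..u+\<rho>}. \<delta> \<le> Z n s k))"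
proof (cases "0 < x u k")
  case True
  define T where "T = u + 1"
  have T: "0 < T" using u by (simp add: T_def)
  define \<delta> where "\<delta> = x u k / 2"
  have \<delta>: "0 < \<delta>" "\<delta> < x u k" using True by (auto simp: \<delta>_def)
  have "((\<lambda>\<rho>::real. C T * \<rho> powr \<alpha>) \<longlongrightarrow> C T * 0) (at_right 0)"
  proof (intro tendsto_mult tendsto_const tendsto_zero_powrI[where b = \<alpha>])
    show "\<forall>\<^sub>F \<rho> in at_right 0. 0 \<le> (\<rho>::real)"
      unfolding eventually_at_right_field by (intro exI[of _ 1]) auto
  qed (use alpha in auto)
  then have "\<forall>\<^sub>F \<rho> in at_right 0. C T * \<rho> powr \<alpha> < \<delta> / 2"
    using \<delta> by (intro order_tendstoD(2)) auto
  moreover have "\<forall>\<^sub>F \<rho> in at_right 0. 0 < \<rho> \<and> \<rho> < min 1 (u::real)"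
    unfolding eventually_at_right_field using u by (intro exI[of _ "min 1 u"]) auto
  ultimately show ?thesis
  proof eventually_elim
    case (elim \<rho>)
    have small: "C T * \<bar>s - u\<bar> powr \<alpha> \<le> \<delta> / 2" if "s \<in> {u-\<rho>..u+\<rho>}" for s
    proof -
      have "C T * \<bar>s - u\<bar> powr \<alpha> \<le> C T * \<rho> powr \<alpha>"
        using that NKC[OF T] alpha by (intro mult_left_mono powr_mono2) auto
      then show ?thesis using elim by linarith
    qed
    have x: "\<delta> / 2 \<le> x s k" if s: "s \<in> {u-\<rho>..u+\<rho>}" for s
    proof -
      have "\<bar>x s k - x u k\<bar> \<le> C T * \<bar>s - u\<bar> powr \<alpha>"
        using limit_hoelder[OF T, of s u k] limit_hoelder[OF T, of u s k] s elim u
        by (cases "s \<le> u") (auto simp: T_def abs_minus_commute)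
      then show ?thesis using small[OF s] \<delta> by linarith
    qed
    have "\<forall>\<^sub>F n in sequentially. \<delta> < Z n u k" using order_tendstoD(1)[OF lim \<delta>(2)] u by simp
    then have "\<forall>\<^sub>F n in sequentially. \<forall>s\<in>{u-\<rho>..u+\<rho>}. \<delta> / 2 \<le> Z n s k"
      using eventually_hoelder[OF T, of k]
    proof eventually_elim
      case el: (elim n)
      show ?case
      proof
        fix s assume s: "s \<in> {u-\<rho>..u+\<rho>}"
        have "\<bar>Z n s k - Z n u k\<bar> \<le> C T * \<bar>s - u\<bar> powr \<alpha>"
          using el(2)[rule_format, of s u] el(2)[rule_format, of u s] s elim u
          by (cases "s \<le> u") (auto simp: T_def abs_minus_commute)
        then show "\<delta> / 2 \<le> Z n s k" using small[OF s] el(1) by linarith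
      qed
    qed
    then show ?case using x \<delta> by (intro exI[of _ "\<delta> / 2"]) auto
  qed
next
  case False
  then obtain s0 where s0: "0 \<le> s0" "s0 < u" "x s0 k = 0" using reg by auto
  have "\<forall>\<^sub>F \<rho> in at_right 0. 0 < \<rho> \<and> \<rho> < (u::real) - s0"
    unfolding eventually_at_right_field using s0 by (intro exI[of _ "u - s0"]) auto
  then show ?thesis
  proof eventually_elim
    case (elim \<rho>)
    have "\<forall>s\<in>{u-\<rho>..u+\<rho>}. x s k = 0" using limit_dead[OF s0(1) _ s0(3)] elim by auto
    moreover have "\<forall>\<^sub>F n in sequentially. Z n (u - \<rho>) k = 0"
      using limit_dead_eventually[OF s0(1) _ s0(3)] elim by auto
    then have "\<forall>\<^sub>F n in sequentially. \<forall>s\<in>{u-\<rho>..u+\<rho>}. Z n s k = 0"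
    proof eventually_elim
      case el: (elim n)
      show ?case
      proof
        fix s assume "s \<in> {u-\<rho>..u+\<rho>}"
        then show "Z n s k = 0" using s0 elim by (intro coarsening.dead[OF coarse _ _ el]) auto
      qed
    qed
    ultimately show ?case by (intro exI[of _ 1]) auto
  qed
qed

text \<open>Near \<open>u\<close> the living pattern in the window is constant in time and
  eventually in \<open>n\<close>. There the right-hand sides converge boundedly, the integrated
  equation passes to the limit, and its integrand is continuous.\<close>

lemma limit_derivative:
  assumes u: "0 < u" "u < T"
    and reg: "\<And>k. k \<in> {j - N T..j + N T} \<Longrightarrow> 0 < x u k \<or> (\<exists>s. 0 \<le> s \<and> s < u \<and> x s k = 0)"
  shows "((\<lambda>t. x t j) has_vector_derivative lapg \<beta> 0 (x u) j) (at u)"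
proof -
  have T: "0 < T" using u by simp
  let ?W = "{j - N T..j + N T}"
  have "\<forall>\<^sub>F \<rho> in at_right 0. \<forall>k\<in>?W. \<exists>\<delta>>0.
     ((\<forall>s\<in>{u-\<rho>..u+\<rho>}. x s k = 0) \<and> (\<forall>\<^sub>F n in sequentially. \<forall>s\<in>{u-\<rho>..u+\<rho>}. Z n s k = 0)) \<or>
     ((\<forall>s\<in>{u-\<rho>..u+\<rho>}. \<delta> \<le> x s k) \<and> (\<forall>\<^sub>F n in sequentially. \<forall>s\<in>{u-\<rho>..u+\<rho>}. \<delta> \<le> Z n s k))"
    using locally_dead_or_bounded_below[OF u(1) reg] by (intro eventually_ball_finite) auto
  moreover have "\<forall>\<^sub>F \<rho> in at_right 0. 0 < \<rho> \<and> \<rho> < min u (T - u)"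
    unfolding eventually_at_right_field using u by (intro exI[of _ "min u (T - u)"]) auto
  ultimately have "\<forall>\<^sub>F \<rho> in at_right 0. 0 < \<rho> \<and> \<rho> < min u (T - u) \<and> (\<forall>k\<in>?W. \<exists>\<delta>>0.
     ((\<forall>s\<in>{u-\<rho>..u+\<rho>}. x s k = 0) \<and> (\<forall>\<^sub>F n in sequentially. \<forall>s\<in>{u-\<rho>..u+\<rho>}. Z n s k = 0)) \<or>
     ((\<forall>s\<in>{u-\<rho>..u+\<rho>}. \<delta> \<le> x s k) \<and> (\<forall>\<^sub>F n in sequentially. \<forall>s\<in>{u-\<rho>..u+\<rho>}. \<delta> \<le> Z n s k)))"
    by eventually_elim blast
  from eventually_happens'[OF trivial_limit_at_right_real this]
  obtain \<rho> where \<rho>': "0 < \<rho>" "\<rho> < min u (T - u)" and ex: "\<forall>k\<in>?W. \<exists>\<delta>>0.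
     ((\<forall>s\<in>{u-\<rho>..u+\<rho>}. x s k = 0) \<and> (\<forall>\<^sub>F n in sequentially. \<forall>s\<in>{u-\<rho>..u+\<rho>}. Z n s k = 0)) \<or>
     ((\<forall>s\<in>{u-\<rho>..u+\<rho>}. \<delta> \<le> x s k) \<and> (\<forall>\<^sub>F n in sequentially. \<forall>s\<in>{u-\<rho>..u+\<rho>}. \<delta> \<le> Z n s k))"
    by blast
  have \<rho>: "0 < \<rho>" "\<rho> < u" "u + \<rho> < T" using \<rho>' by auto
  from bchoice[OF ex] obtain \<delta> where \<delta>_all: "\<forall>k\<in>?W. 0 < \<delta> k \<and> (((\<forall>s\<in>{u-\<rho>..u+\<rho>}. x s k = 0) \<and> (\<forall>\<^sub>F n in sequentially. \<forall>s\<in>{u-\<rho>..u+\<rho>}. Z n s k = 0)) \<or>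
     ((\<forall>s\<in>{u-\<rho>..u+\<rho>}. \<delta> k \<le> x s k) \<and> (\<forall>\<^sub>F n in sequentially. \<forall>s\<in>{u-\<rho>..u+\<rho>}. \<delta> k \<le> Z n s k)))" ..
  have \<delta>: "0 < \<delta> k" and dich: "((\<forall>s\<in>{u-\<rho>..u+\<rho>}. x s k = 0) \<and> (\<forall>\<^sub>F n in sequentially. \<forall>s\<in>{u-\<rho>..u+\<rho>}. Z n s k = 0)) \<or>
     ((\<forall>s\<in>{u-\<rho>..u+\<rho>}. \<delta> k \<le> x s k) \<and> (\<forall>\<^sub>F n in sequentially. \<forall>s\<in>{u-\<rho>..u+\<rho>}. \<delta> k \<le> Z n s k))" if "k \<in> ?W" for k
    using bspec[OF \<delta>_all that] by simp_all
  let ?J = "{u-\<rho>..u+\<rho>}"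
  have J: "0 \<le> s" "s \<le> T" if "s \<in> ?J" for s using that \<rho> by auto
  have uJ: "u \<in> ?J" using \<rho> by simp
  have pattern: "0 < x s k \<longleftrightarrow> 0 < x u k" if "s \<in> ?J" "k \<in> ?W" for s k
    using dich[OF that(2)]
  proof (elim disjE conjE)
    assume *: "\<forall>s\<in>?J. x s k = 0"
    show ?thesis using bspec[OF * that(1)] bspec[OF * uJ] by simp
  next
    assume *: "\<forall>s\<in>?J. \<delta> k \<le> x s k"
    show ?thesis using bspec[OF * that(1)] bspec[OF * uJ] \<delta>[OF that(2)] by simp
  qed
  obtain p where p: "p \<in> {j - N T..j - N T + N T - 1}" "D / 2 \<le> x u p" using limit_anchor[OF T, of u "j - N T"] u by auto
  obtain q where q: "q \<in> {j + 1..j + 1 + N T - 1}" "D / 2 \<le> x u q" using limit_anchor[OF T, of u "j + 1"] u by auto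
  have pq: "p \<le> j - 1" "j + 1 \<le> q" "{p..q} \<subseteq> ?W" using p(1) q(1) NKC[OF T] by auto
  have pqW: "p \<in> ?W" "q \<in> ?W" using pq by auto
  have pqpos: "0 < x s p" "0 < x s q" if "s \<in> ?J" for s
    using pattern[OF that pqW(1)] pattern[OF that pqW(2)] p(2) q(2) D by linarith+
  let ?f = "\<lambda>s. lapg \<beta> 0 (x s) j"
  have conv: "(\<lambda>n. lapg \<beta> (e n) (Z n s) j) \<longlonglongrightarrow> ?f s" if s: "s \<in> ?J" for s
  proof (rule lapg_tendsto[OF e pq(1) pqpos(1)[OF s] pq(2) pqpos(2)[OF s]])
    show "(\<lambda>n. Z n s k) \<longlonglongrightarrow> x s k" for k by (rule lim[OF J(1)[OF s]])
    show "\<forall>\<^sub>F n in sequentially. Z n s k = 0" if "p \<le> k" "k \<le> q" "\<not> 0 < x s k" for k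
    proof -
      have k: "k \<in> ?W" using pq(3) that by auto
      show ?thesis using dich[OF k]
      proof (elim disjE conjE)
        assume "\<forall>\<^sub>F n in sequentially. \<forall>s\<in>?J. Z n s k = 0"
        then show ?thesis by eventually_elim (use s in blast)
      next
        assume *: "\<forall>s\<in>?J. \<delta> k \<le> x s k"
        show ?thesis using bspec[OF * s] \<delta>[OF k] that by simp
      qed
    qed
  qed
  have contf: "continuous_on ?J ?f"
  proof (rule continuous_on_sequentiallyI)
    fix v a assume v: "\<forall>n. v n \<in> ?J" "a \<in> ?J" "v \<longlonglongrightarrow> a"
    show "(\<lambda>n. ?f (v n)) \<longlonglongrightarrow> ?f a"
    proof (rule lapg_tendsto[OF _ pq(1) pqpos(1)[OF v(2)] pq(2) pqpos(2)[OF v(2)]])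
      show "(\<lambda>n. x (v n) k) \<longlonglongrightarrow> x a k" for k
      proof (rule continuous_on_tendsto_compose[OF limit_continuous v(3)])
        show "a \<in> {0..}" using J(1)[OF v(2)] by simp
        show "\<forall>\<^sub>F n in sequentially. v n \<in> {0..}"
          using J(1)[OF v(1)[rule_format]] by (simp only: atLeast_iff eventually_True)
      qed
      show "\<forall>\<^sub>F n in sequentially. x (v n) k = 0" if "p \<le> k" "k \<le> q" "\<not> 0 < x a k" for k
      proof (rule always_eventually, rule allI)
        fix n
        have k: "k \<in> ?W" using pq(3) that by auto
        have vn: "v n \<in> ?J" using v by simp
        have "\<not> 0 < x (v n) k" using pattern[OF vn k] pattern[OF v(2) k] that by simp
        then show "x (v n) k = 0" using limit_nonneg[of "v n" k] J(1)[OF vn] by simp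
      qed
    qed simp
  qed
  \<comment> \<open>Living particles of the window are bounded below by \<open>\<delta>\<close>, for
    large \<open>n\<close> uniformly on \<open>?J\<close>; this gives a constant majorant.\<close>
  define Bd where "Bd = 2 * (\<Sum>k\<in>?W. \<delta> k powr (- \<beta>))"
  have "\<forall>\<^sub>F n in sequentially. \<forall>k\<in>?W. \<forall>s\<in>?J. Z n s k = 0 \<or> \<delta> k \<le> Z n s k"
  proof (rule eventually_ball_finite)
    show "\<forall>k\<in>?W. \<forall>\<^sub>F n in sequentially. \<forall>s\<in>?J. Z n s k = 0 \<or> \<delta> k \<le> Z n s k"
    proof
      fix k assume "k \<in> ?W"
      from dich[OF this] show "\<forall>\<^sub>F n in sequentially. \<forall>s\<in>?J. Z n s k = 0 \<or> \<delta> k \<le> Z n s k"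
        by (auto elim: eventually_mono)
    qed
  qed simp
  then have "\<forall>\<^sub>F n in sequentially. \<forall>s\<in>?J. \<bar>lapg \<beta> (e n) (Z n s) j\<bar> \<le> Bd"
    using eventually_anchor[OF T, of "j - N T"] eventually_anchor[OF T, of "j + 1"]
  proof eventually_elim
    case (elim n)
    show ?case
    proof
      fix s assume s: "s \<in> ?J"
      obtain p' where p': "p' \<in> {j - N T..j - 1}" "0 < Z n s p'"
        using elim(2)[rule_format, OF J[OF s]] D by force
      obtain q' where q': "q' \<in> {j + 1..j + N T}" "0 < Z n s q'"
        using elim(3)[rule_format, OF J[OF s]] D by force
      have "\<bar>lapg \<beta> (e n) (Z n s) j\<bar> \<le>
          2 * (\<Sum>k\<in>?W. if 0 < Z n s k then (Z n s k + e n) powr (- \<beta>) else 0)"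
        by (rule lapg_abs_le[OF p' q'])
      also have "\<dots> \<le> Bd"
        unfolding Bd_def
      proof (intro mult_left_mono sum_mono)
        fix k assume k: "k \<in> ?W"
        show "(if 0 < Z n s k then (Z n s k + e n) powr (- \<beta>) else 0) \<le> \<delta> k powr (- \<beta>)"
          using elim(1)[rule_format, OF k s] \<delta>[OF k]
          by (auto intro!: coarsening.powr_le_base[OF coarse])
      qed simp
      finally show "\<bar>lapg \<beta> (e n) (Z n s) j\<bar> \<le> Bd" .
    qed
  qed
  then obtain n0 where n0: "\<And>n s. n0 \<le> n \<Longrightarrow> s \<in> ?J \<Longrightarrow> \<bar>lapg \<beta> (e n) (Z n s) j\<bar> \<le> Bd"
    unfolding eventually_sequentially by blast
  have eqn: "integral {u-\<rho>..b} ?f = x b j - x (u - \<rho>) j" if b: "b \<in> ?J" for b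
  proof -
    have sub: "s \<in> ?J" if "s \<in> {u-\<rho>..b}" for s using that b by auto
    have int: "((\<lambda>s. lapg \<beta> (e (n + n0)) (Z (n + n0) s) j) has_integral
        (Z (n + n0) b j - Z (n + n0) (u - \<rho>) j)) {u-\<rho>..b}" for n
      using b \<rho> by (intro coarsening.eqn[OF coarse]) auto
    have "(\<lambda>n. integral {u-\<rho>..b} (\<lambda>s. lapg \<beta> (e (n + n0)) (Z (n + n0) s) j)) \<longlonglongrightarrow> integral {u-\<rho>..b} ?f"
    proof (rule dominated_convergence(2)[where h = "\<lambda>s. Bd"])
      show "(\<lambda>s. lapg \<beta> (e (n + n0)) (Z (n + n0) s) j) integrable_on {u-\<rho>..b}" for n
        using int by blast
      show "norm (lapg \<beta> (e (n + n0)) (Z (n + n0) s) j) \<le> Bd" if "s \<in> {u-\<rho>..b}" for n s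
        using n0[of "n + n0" s] sub[OF that] by simp
      show "(\<lambda>n. lapg \<beta> (e (n + n0)) (Z (n + n0) s) j) \<longlonglongrightarrow> ?f s" if "s \<in> {u-\<rho>..b}" for s
        using LIMSEQ_ignore_initial_segment[OF conv[OF sub[OF that]], of n0] by simp
    qed auto
    moreover have "(\<lambda>n. Z (n + n0) b j - Z (n + n0) (u - \<rho>) j) \<longlonglongrightarrow> x b j - x (u - \<rho>) j"
      using b \<rho> by (intro tendsto_diff LIMSEQ_ignore_initial_segment lim) auto
    then have "(\<lambda>n. integral {u-\<rho>..b} (\<lambda>s. lapg \<beta> (e (n + n0)) (Z (n + n0) s) j)) \<longlonglongrightarrow> x b j - x (u - \<rho>) j"
      by (simp add: integral_unique[OF int])
    ultimately show ?thesis using LIMSEQ_unique by blast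
  qed
  have "((\<lambda>b. integral {u-\<rho>..b} ?f) has_vector_derivative ?f u) (at u within ?J)"
    by (rule integral_has_vector_derivative[OF contf uJ])
  then have "((\<lambda>b. x (u - \<rho>) j + integral {u-\<rho>..b} ?f) has_vector_derivative ?f u) (at u within ?J)"
    using has_vector_derivative_add[OF has_vector_derivative_const] by fastforce
  then have "((\<lambda>b. x b j) has_vector_derivative ?f u) (at u within ?J)"
    by (rule has_vector_derivative_transform[rotated 2]) (use uJ eqn in auto)
  then show ?thesis using \<rho> by (simp add: at_within_Icc_at)
qed

text \<open>The limit is continuous and has the right derivative off a finite set. The fundamental
  theorem for the gauge integral then gives the equation without prior integrability of the singular
  right-hand side.\<close>

theorem limit_coarsening: "coarsening \<beta> 0 x"
proof
  show "((\<lambda>s. lapg \<beta> 0 (x s) j) has_integral (x t2 j - x t1 j)) {t1..t2}"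
    if t: "0 \<le> t1" "t1 \<le> t2" for t1 t2 j
  proof -
    define T where "T = t2 + 1"
    have T: "0 < T" using t by (simp add: T_def)
    \<comment> \<open>\<open>S k\<close> consists of the first zero of particle \<open>k\<close>, if
      there is one.\<close>
    define S where "S k = {s. 0 \<le> s \<and> x s k = 0 \<and> (\<forall>r. 0 \<le> r \<and> r < s \<longrightarrow> x r k \<noteq> 0)}" for k
    have uniq: "s = s'" if "s \<in> S k" "s' \<in> S k" for s s' k
      using that unfolding S_def by (cases s s' rule: linorder_cases) auto
    have "finite (S k)" for k
    proof (cases "S k = {}")
      case False
      then obtain s where "s \<in> S k" by blast
      then have "S k \<subseteq> {s}" using uniq by blast
      then show ?thesis by (rule finite_subset) simp
    qed simp
    then have fin: "finite (\<Union>k\<in>{j - N T..j + N T}. S k)" by simp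
    show ?thesis
    proof (rule fundamental_theorem_of_calculus_interior_strong[OF fin t(2)])
      show "continuous_on {t1..t2} (\<lambda>t. x t j)"
        using t by (intro continuous_on_subset[OF limit_continuous]) auto
      fix u assume u: "u \<in> {t1<..<t2} - (\<Union>k\<in>{j - N T..j + N T}. S k)"
      have u0: "0 < u" "u < T" using u t by (auto simp: T_def)
      show "((\<lambda>t. x t j) has_vector_derivative lapg \<beta> 0 (x u) j) (at u)"
      proof (rule limit_derivative[OF u0])
        fix k assume k: "k \<in> {j - N T..j + N T}"
        then have "u \<notin> S k" using u by blast
        then show "0 < x u k \<or> (\<exists>s. 0 \<le> s \<and> s < u \<and> x s k = 0)"
          using limit_nonneg[of u k] u0 unfolding S_def by force
      qed
    qed
  qed
qed (use beta limit_nonneg limit_dead limit_continuous in auto)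

end

section \<open>Existence and integrability\<close>

definition apriori_constants where
  "apriori_constants \<beta> D M T N K C \<longleftrightarrow> 0 < N \<and> 0 < K \<and> 0 \<le> C \<and> (\<forall>\<epsilon> x lo hi. coarsening \<beta> \<epsilon> x \<longrightarrow>
    dense_windows lo hi M D (x 0) \<longrightarrow> apriori_bounds \<beta> D T N K C \<epsilon> x lo hi)"

lemma coarsening_exists:
  assumes beta: "0 < \<beta>" and D: "0 < D" and M: "0 < M" and pos: "\<And>j. 0 < x0 j"
    and dense: "\<And>lo hi. dense_windows lo hi M D x0"
  obtains x where "coarsening \<beta> 0 x" "x 0 = x0"
proof -
  have "\<forall>T. \<exists>N K C. 0 < T \<longrightarrow> apriori_constants \<beta> D M T N K C"
    using apriori[OF beta D M] unfolding apriori_constants_def by blast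
  then obtain N K C where NKC: "\<And>T. 0 < T \<Longrightarrow> apriori_constants \<beta> D M T (N T) (K T) (C T)" by metis
  define z where "z n j = (if \<bar>j\<bar> \<le> int n then x0 j else 0)" for n :: nat and j
  define e where "e n = inverse (real (Suc n))" for n
  have "\<exists>x. coarsening \<beta> (e n) x \<and> x 0 = z n" for n
    by (rule finite_coarsening_exists[of _ _ "{- int n..int n}"]) (use beta pos in \<open>auto simp: e_def z_def\<close>)
  then obtain Z where Z: "\<And>n. coarsening \<beta> (e n) (Z n)" "\<And>n. Z n 0 = z n" by metis
  have "dense_windows (- int n) (int n) M D (z n)" for n
    unfolding dense_windows_def
  proof (intro allI impI)
    fix a assume a: "- int n \<le> a \<and> a + M \<le> int n + 1"
    have "(\<Sum>j=a..a+M-1. z n j) = (\<Sum>j=a..a+M-1. x0 j)"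
      by (rule sum.cong) (use a in \<open>auto simp: z_def\<close>)
    then show "real_of_int M * D \<le> (\<Sum>j=a..a+M-1. z n j)"
      using dense[of a "a + M"] by (auto simp: dense_windows_def)
  qed
  then have bounds: "apriori_bounds \<beta> D T (N T) (K T) (C T) (e n) (Z n) (- int n) (int n)" if "0 < T" for T n
    using NKC[OF that] Z unfolding apriori_constants_def by metis
  have N0: "0 < T \<Longrightarrow> 0 < N T \<and> 0 < K T \<and> 0 \<le> C T" for T
    using NKC[of T] by (simp add: apriori_constants_def)
  have elim: "e \<longlonglongrightarrow> 0" unfolding e_def by (rule LIMSEQ_inverse_real_of_nat)
  have init: "(\<lambda>n. Z n 0 j) \<longlonglongrightarrow> x0 j" for j
  proof (rule tendsto_eventually)
    have "Z n 0 j = x0 j" if "nat \<bar>j\<bar> \<le> n" for n using that by (simp add: Z(2) z_def)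
    then show "\<forall>\<^sub>F n in sequentially. Z n 0 j = x0 j" unfolding eventually_sequentially by blast
  qed
  interpret A: approximation \<beta> D N K C e Z id
    by (rule approximation.intro) (use beta D N0 elim Z bounds in \<open>auto simp: strict_mono_def\<close>)
  obtain d where d: "strict_mono d" "\<And>t j. 0 \<le> t \<Longrightarrow> convergent (\<lambda>n. Z (d n) t j)"
    using A.convergent_subsequence init convergent_def by metis
  define x where "x t j = lim (\<lambda>n. Z (d n) t j)" for t j
  interpret B: approximation_limit \<beta> D N K C "e \<circ> d" "\<lambda>n. Z (d n)" d x
  proof (intro approximation_limit.intro approximation.intro approximation_limit_axioms.intro)
    show "(e \<circ> d) \<longlonglongrightarrow> 0" by (rule LIMSEQ_subseq_LIMSEQ[OF elim d(1)])
    show "coarsening \<beta> ((e \<circ> d) n) (Z (d n))" for n using Z(1)[of "d n"] by simp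
    show "apriori_bounds \<beta> D T (N T) (K T) (C T) ((e \<circ> d) n) (Z (d n)) (- int (d n)) (int (d n))"
      if "0 < T" for T n using bounds[OF that, of "d n"] by simp
    show "(\<lambda>n. Z (d n) t j) \<longlonglongrightarrow> x t j" if "0 \<le> t" for t j
      using d(2)[OF that] by (simp add: x_def convergent_LIMSEQ_iff)
  qed (use beta D N0 d(1) in auto)
  have "x 0 j = x0 j" for j
    using LIMSEQ_unique[OF B.lim[of 0 j] LIMSEQ_subseq_LIMSEQ[OF init d(1), unfolded o_def]] by simp
  then show thesis using that B.limit_coarsening by blast
qed

text \<open>The living set varies with \<open>s\<close>. Starting from a site \<open>p\<close> that
  is alive at all times, moving one site to the right is a measurable case distinction.\<close>

lemma lft_measurable:
  fixes w :: "real \<Rightarrow> int \<Rightarrow> real"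
  assumes w: "\<And>k. (\<lambda>s. w s k) \<in> borel_measurable borel" and "p \<le> i" "\<And>s. 0 < w s p"
  shows "(\<lambda>s. lft {k. 0 < w s k} (\<lambda>k. w s k powr (- \<beta>)) i) \<in> borel_measurable borel"
  using assms(2)
proof (induction i rule: int_ge_induct)
  case base
  then show ?case using w assms(3) by simp
next
  case (step i)
  have "lft {k. 0 < w s k} (\<lambda>k. w s k powr (- \<beta>)) (i + 1) =
      (if 0 < w s (i + 1) then w s (i + 1) powr (- \<beta>) else lft {k. 0 < w s k} (\<lambda>k. w s k powr (- \<beta>)) i)" for s
    by (simp add: lft_notmem[of "i + 1"])
  then show ?case using w step by simp
qed

lemma rgt_measurable:
  fixes w :: "real \<Rightarrow> int \<Rightarrow> real"
  assumes w: "\<And>k. (\<lambda>s. w s k) \<in> borel_measurable borel" and "i \<le> q" "\<And>s. 0 < w s q"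
  shows "(\<lambda>s. rgt {k. 0 < w s k} (\<lambda>k. w s k powr (- \<beta>)) i) \<in> borel_measurable borel"
  using assms(2)
proof (induction i rule: int_le_induct)
  case base
  then show ?case using w assms(3) by simp
next
  case (step i)
  have "rgt {k. 0 < w s k} (\<lambda>k. w s k powr (- \<beta>)) (i - 1) =
      (if 0 < w s (i - 1) then w s (i - 1) powr (- \<beta>) else rgt {k. 0 < w s k} (\<lambda>k. w s k powr (- \<beta>)) i)" for s
    by (simp add: rgt_notmem[of "i - 1"])
  then show ?case using w step by simp
qed

text \<open>A nonnegative gauge integrable majorant is Lebesgue integrable, which transfers to
  \<open>f\<close>. The Borel function \<open>g\<close> supplies measurability, and the majorant is
  adjusted at \<open>b\<close>, where no bound is given.\<close>

lemma set_integrable_dominated: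
  fixes f H :: "real \<Rightarrow> real"
  assumes "(H has_integral I) {a..b}" "\<And>s. 0 \<le> H s" "\<And>s. s \<in> {a..<b} \<Longrightarrow> \<bar>f s\<bar> \<le> H s"
    and g: "g \<in> borel_measurable borel" "\<And>s. s \<in> {a..b} \<Longrightarrow> f s = g s"
  shows "set_integrable lborel {a..b} f"
proof -
  let ?H = "\<lambda>s. if s = b then \<bar>f b\<bar> else H s"
  have "(?H has_integral I) {a..b}"
    by (rule has_integral_spike_finite[OF _ _ assms(1), of "{b}"]) auto
  then have "?H absolutely_integrable_on {a..b}"
    using assms(2) by (intro nonnegative_absolutely_integrable_1) auto
  then have H: "integrable lebesgue (\<lambda>s. indicator {a..b} s *\<^sub>R ?H s)" by (simp add: set_integrable_def)
  have m: "(\<lambda>s. indicator {a..b} s *\<^sub>R g s) \<in> borel_measurable lborel" using g(1) by simp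
  have "integrable lebesgue (\<lambda>s. indicator {a..b} s *\<^sub>R g s)"
  proof (rule Bochner_Integration.integrable_bound[OF H])
    show "(\<lambda>s. indicator {a..b} s *\<^sub>R g s) \<in> borel_measurable lebesgue"
      by (rule measurable_completion[OF m])
    show "AE s in lebesgue. norm (indicator {a..b} s *\<^sub>R g s) \<le> norm (indicator {a..b} s *\<^sub>R ?H s)"
      using assms(2,3) g(2) by (intro AE_I2) (auto simp: indicator_def)
  qed
  then have "integrable lborel (\<lambda>s. indicator {a..b} s *\<^sub>R g s)" using integrable_completion[OF m] by simp
  moreover have "(\<lambda>s. indicator {a..b} s *\<^sub>R g s) = (\<lambda>s. indicator {a..b} s *\<^sub>R f s)"
    using g(2) by (auto simp: indicator_def)
  ultimately show ?thesis by (simp add: set_integrable_def)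
qed

text \<open>Any \<open>2 * L\<close> consecutive sites contain a whole aligned block, which carries
  mass \<open>L * d\<close>; positivity allows the other sites to be dropped. Rounding
  \<open>(a - k0) / L\<close> up finds this block.\<close>

lemma aligned_blocks_dense:
  fixes x0 :: "int \<Rightarrow> real"
  assumes "0 < L" "\<And>j. 0 < x0 j"
    "\<And>k. (1 / real_of_int L) * (\<Sum>j = k0 + k * L..k0 + (k + 1) * L - 1. x0 j) \<ge> d"
  shows "dense_windows lo hi (2 * L) (d / 2) x0"
  unfolding dense_windows_def
proof (intro allI impI)
  fix a
  define k where "k = (a - k0 + L - 1) div L"
  have "k * L = a - k0 + L - 1 - (a - k0 + L - 1) mod L" by (simp add: k_def minus_mod_eq_div_mult)
  moreover have "0 \<le> (a - k0 + L - 1) mod L" "(a - k0 + L - 1) mod L < L" using assms by auto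
  ultimately have k: "a \<le> k0 + k * L" "k0 + k * L + L \<le> a + 2 * L" by linarith+
  have "real_of_int L * d \<le> (\<Sum>j = k0 + k * L..k0 + (k + 1) * L - 1. x0 j)"
    using assms(3)[of k] assms(1) by (simp add: field_simps)
  also have "\<dots> \<le> (\<Sum>j=a..a+2*L-1. x0 j)"
    using k assms(2) by (intro sum_mono2) (auto simp: algebra_simps less_imp_le)
  finally show "real_of_int (2 * L) * (d / 2) \<le> (\<Sum>j=a..a+2*L-1. x0 j)" by simp
qed

section \<open>Properties of the solution\<close>

context coarsening begin

text \<open>Clamping time to \<open>t1..t2\<close> turns the particles into functions continuous on
  the whole line, and sites alive at \<open>t2\<close> are then alive at all times, as
  \<open>lft_measurable\<close> and \<open>rgt_measurable\<close> require.\<close>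

lemma lapg_borel:
  assumes t: "0 \<le> t1" "t1 \<le> t2" and p: "p \<le> j - 1" "0 < x t2 p" and q: "j + 1 \<le> q" "0 < x t2 q"
  obtains g where "g \<in> borel_measurable borel" "\<And>s. s \<in> {t1..t2} \<Longrightarrow> lapg \<beta> 0 (x s) j = g s"
    and "(\<lambda>s. x (max t1 (min t2 s)) j) \<in> borel_measurable borel"
proof -
  define w where "w s k = x (max t1 (min t2 s)) k" for s k
  have w: "(\<lambda>s. w s k) \<in> borel_measurable borel" for k
    unfolding w_def using t
    by (intro borel_measurable_continuous_onI continuous_on_compose2[OF cont] continuous_intros) auto
  have wpos: "0 < w s k" if "0 < x t2 k" for s k
    unfolding w_def using t by (intro alive_before[OF _ _ that]) auto
  have "(\<lambda>s. lapg \<beta> 0 (w s) j) \<in> borel_measurable borel"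
  proof -
    have "(\<lambda>s. lft {k. 0 < w s k} (\<lambda>k. w s k powr (- \<beta>)) (j - 1)) \<in> borel_measurable borel"
      "(\<lambda>s. lft {k. 0 < w s k} (\<lambda>k. w s k powr (- \<beta>)) j) \<in> borel_measurable borel"
      "(\<lambda>s. rgt {k. 0 < w s k} (\<lambda>k. w s k powr (- \<beta>)) (j + 1)) \<in> borel_measurable borel"
      "(\<lambda>s. rgt {k. 0 < w s k} (\<lambda>k. w s k powr (- \<beta>)) j) \<in> borel_measurable borel"
      using p q wpos by (auto intro!: lft_measurable[OF w, of p] rgt_measurable[OF w, of _ q])
    then show ?thesis by (simp add: lapg_def lap_def)
  qed
  moreover have "w s = x s" if "s \<in> {t1..t2}" for s using that by (auto simp: w_def fun_eq_iff)
  ultimately show thesis using that[of "\<lambda>s. lapg \<beta> 0 (w s) j"] w[of j] unfolding w_def by auto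
qed

lemma powr_le_imp_ge:
  fixes c X :: real
  assumes "0 \<le> c" "0 \<le> X" "c \<le> X powr (\<beta> + 1)"
  shows "c powr (1 / (\<beta> + 1)) \<le> X"
proof -
  have "c powr (1 / (\<beta> + 1)) \<le> (X powr (\<beta> + 1)) powr (1 / (\<beta> + 1))"
    using assms beta by (intro powr_mono2) auto
  then show ?thesis using assms(2) beta by (simp add: powr_powr)
qed

text \<open>The contrapositive of \<open>persist\<close> with the size at time \<open>t\<close>,
  solved for that size. No density enters, so the constant depends on \<beta> only.\<close>

lemma upper_rate:
  assumes "0 \<le> t" "t \<le> \<tau>" "x \<tau> j = 0"
  shows "x t j \<le> 2 * 4 powr (1 / (\<beta> + 1)) * (\<tau> - t) powr (1 / (\<beta> + 1))"
proof (cases "x t j = 0")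
  case False
  define X where "X = x t j"
  have X: "0 < X" using False nonneg[OF assms(1), of j] by (simp add: X_def)
  have "\<not> \<tau> \<le> t + 1/4 * (X / 2) powr (\<beta> + 1)"
    using persist[of t X j \<tau>] X assms by (auto simp: X_def)
  then have "(X / 2) powr (\<beta> + 1) \<le> 4 * (\<tau> - t)" by simp
  then have "((X / 2) powr (\<beta> + 1)) powr (1 / (\<beta> + 1)) \<le> (4 * (\<tau> - t)) powr (1 / (\<beta> + 1))"
    using beta by (intro powr_mono2) auto
  also have "\<dots> = 4 powr (1 / (\<beta> + 1)) * (\<tau> - t) powr (1 / (\<beta> + 1))"
    by (rule powr_mult)
  finally have "X / 2 \<le> 4 powr (1 / (\<beta> + 1)) * (\<tau> - t) powr (1 / (\<beta> + 1))"
    using X beta by (simp add: powr_powr)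
  then show ?thesis by (simp add: X_def)
qed (simp)

end

lemma hoelder_norm_le:
  assumes T: "0 < T" and "\<And>t. 0 \<le> t \<Longrightarrow> t \<le> T \<Longrightarrow> \<bar>f t\<bar> \<le> A"
    and "\<And>t1 t2. 0 \<le> t1 \<Longrightarrow> t1 \<le> t2 \<Longrightarrow> t2 \<le> T \<Longrightarrow> \<bar>f t2 - f t1\<bar> \<le> B * (t2 - t1) powr \<alpha>"
  shows "hoelder_norm \<alpha> T f \<le> ereal (A + B)"
proof -
  have "(SUP t\<in>{0..T}. ereal \<bar>f t\<bar>) \<le> ereal A"
    using assms(2) by (intro SUP_least) auto
  moreover have "(SUP (t1, t2)\<in>{(t1, t2). 0 \<le> t1 \<and> t1 < t2 \<and> t2 \<le> T}.
        ereal (\<bar>f t2 - f t1\<bar> / \<bar>t2 - t1\<bar> powr \<alpha>)) \<le> ereal B"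
  proof (intro SUP_least, clarify)
    fix t1 t2 assume t: "0 \<le> t1" "t1 < t2" "t2 \<le> T"
    then have "\<bar>f t2 - f t1\<bar> / \<bar>t2 - t1\<bar> powr \<alpha> \<le> B"
      using assms(3)[of t1 t2] by (simp add: divide_le_eq)
    then show "ereal (\<bar>f t2 - f t1\<bar> / \<bar>t2 - t1\<bar> powr \<alpha>) \<le> ereal B" by simp
  qed
  ultimately have "hoelder_norm \<alpha> T f \<le> ereal A + ereal B"
    unfolding hoelder_norm_def by (rule add_mono)
  then show ?thesis by simp
qed

lemma hoelder_continuous_onI:
  assumes "\<And>t1 t2. 0 \<le> t1 \<Longrightarrow> t1 \<le> t2 \<Longrightarrow> t2 \<le> T \<Longrightarrow> \<bar>f t2 - f t1\<bar> \<le> B * (t2 - t1) powr \<alpha>"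
  shows "hoelder_continuous_on \<alpha> {0..T} f"
  unfolding hoelder_continuous_on_def
proof (intro exI[of _ B] ballI)
  fix t1 t2 assume "t1 \<in> {0..T}" "t2 \<in> {0..T}"
  then show "\<bar>f t2 - f t1\<bar> \<le> B * \<bar>t2 - t1\<bar> powr \<alpha>"
    using assms[of t1 t2] assms[of t2 t1] by (cases "t1 \<le> t2") (auto simp: abs_minus_commute)
qed

text \<open>Here \<open>lo\<close> and \<open>hi\<close> are arbitrary, so a range with the required
  margins can be put around any site and the bounds hold everywhere.\<close>

locale dense_coarsening = coarsening \<beta> 0 x for \<beta> x +
  fixes D :: real and M :: int and N :: "real \<Rightarrow> int" and K C :: "real \<Rightarrow> real"
  assumes D: "0 < D" and dense: "dense_windows lo hi M D (x 0)"
    and constants: "0 < T \<Longrightarrow> apriori_constants \<beta> D M T (N T) (K T) (C T)"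
    and bounded: "x 0 \<in> linf_plus"
begin

lemma constants_pos: "0 < T \<Longrightarrow> 0 < N T \<and> 0 < K T \<and> 0 \<le> C T"
  using constants by (simp add: apriori_constants_def)

lemma bounds: "0 < T \<Longrightarrow> apriori_bounds \<beta> D T (N T) (K T) (C T) 0 x lo hi"
  using constants dense coarsening_axioms by (simp add: apriori_constants_def)

lemma hoelder:
  "0 < T \<Longrightarrow> 0 \<le> t1 \<Longrightarrow> t1 \<le> t2 \<Longrightarrow> t2 \<le> T \<Longrightarrow> \<bar>x t2 j - x t1 j\<bar> \<le> C T * (t2 - t1) powr (1 / (\<beta> + 1))"
  using bounds[of T "j - 2 * N T" "j + 2 * N T"] unfolding apriori_bounds_def by simp

lemma dominated:
  "0 < T \<Longrightarrow> 0 \<le> t1 \<Longrightarrow> t1 \<le> t2 \<Longrightarrow> t2 \<le> T \<Longrightarrow> dominated_rate \<beta> 0 (C T) x t1 t2 j"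
  using bounds[of T "j - 2 * N T" "j + 2 * N T"] unfolding apriori_bounds_def by simp

lemma lower:
  "0 < T \<Longrightarrow> 0 \<le> t \<Longrightarrow> t \<le> s \<Longrightarrow> s \<le> T \<Longrightarrow> 0 < x s j \<Longrightarrow> K T * (s - t) \<le> x t j powr (\<beta> + 1)"
  using bounds[of T "j - N T" "j + N T"] unfolding apriori_bounds_def by simp

lemma anchor:
  assumes "0 < T" "0 \<le> t" "t \<le> T"
  shows "\<exists>p\<in>{a..a + N T - 1}. D / 2 \<le> x t p"
proof -
  have "anchored a (a + N T) (N T) (D / 2) (x t)"
    using bounds[of T a "a + N T"] assms unfolding apriori_bounds_def by simp
  then show ?thesis unfolding anchored_def by simp
qed

lemma growth:
  assumes "0 < T" "0 \<le> t" "t \<le> T"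
  shows "x t j \<le> x 0 j + C T * T powr (1 / (\<beta> + 1))"
proof -
  have "x t j - x 0 j \<le> C T * (t - 0) powr (1 / (\<beta> + 1))" using hoelder[of T 0 t j] assms by simp
  also have "\<dots> \<le> C T * T powr (1 / (\<beta> + 1))"
    using assms constants_pos[of T] beta by (intro mult_left_mono powr_mono2) auto
  finally show ?thesis by simp
qed

lemma integrability:
  assumes t: "0 \<le> t1" "t1 \<le> t2"
  shows "set_integrable lborel {t1..t2} (\<lambda>s. Delta_sigma \<beta> (x s) j)" (is ?A)
    and "set_integrable lborel {t1..t2} (\<lambda>s. x s j powr (- \<beta>) * of_bool (x s j > 0))" (is ?B)
proof -
  define T where "T = t2 + 1"
  have T: "0 < T" "t2 \<le> T" using t by (auto simp: T_def)
  obtain p where p: "p \<in> {j - N T..j - N T + N T - 1}" "D / 2 \<le> x t2 p" using anchor[of T t2 "j - N T"] T t by auto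
  obtain q where q: "q \<in> {j + 1..j + 1 + N T - 1}" "D / 2 \<le> x t2 q" using anchor[of T t2 "j + 1"] T t by auto
  have pq: "p \<le> j - 1" "0 < x t2 p" "j + 1 \<le> q" "0 < x t2 q" using p q D by auto
  obtain g where g: "g \<in> borel_measurable borel" "\<And>s. s \<in> {t1..t2} \<Longrightarrow> lapg \<beta> 0 (x s) j = g s"
    and w: "(\<lambda>s. x (max t1 (min t2 s)) j) \<in> borel_measurable borel"
    using lapg_borel[OF t pq] by blast
  obtain H I where H: "(H has_integral I) {t1..t2}" "\<And>s. 0 \<le> H s"
    and le: "\<And>s. s \<in> {t1..<t2} \<Longrightarrow> \<bar>lapg \<beta> 0 (x s) j\<bar> \<le> H s \<and> (0 < x s j \<longrightarrow> (x s j + 0) powr (- \<beta>) \<le> H s)"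
    using dominated[OF T(1) t T(2), of j] unfolding dominated_rate_def by blast
  show ?A unfolding Delta_sigma_eq
    by (rule set_integrable_dominated[OF H _ g]) (use le in auto)
  show ?B
  proof (rule set_integrable_dominated[OF H])
    show "\<bar>x s j powr (- \<beta>) * of_bool (0 < x s j)\<bar> \<le> H s" if "s \<in> {t1..<t2}" for s
      using le[OF that] H(2)[of s] by (cases "0 < x s j") auto
    show "(\<lambda>s. if 0 < x (max t1 (min t2 s)) j then x (max t1 (min t2 s)) j powr (- \<beta>) else 0) \<in> borel_measurable borel"
      using w by simp
    show "x s j powr (- \<beta>) * of_bool (0 < x s j) =
        (if 0 < x (max t1 (min t2 s)) j then x (max t1 (min t2 s)) j powr (- \<beta>) else 0)"
      if "s \<in> {t1..t2}" for s using that by auto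
  qed
qed

lemma solution: "is_solution \<beta> \<infinity> (x 0) x"
  unfolding is_solution_def
proof (intro conjI allI impI; (elim conjE)?)
  obtain c where c: "\<And>j. x 0 j \<le> c" using bounded by (auto simp: linf_plus_def)
  fix t :: real assume t: "0 \<le> t"
  show "x t \<in> linf_plus"
    unfolding linf_plus_def
  proof (intro CollectI exI allI conjI)
    show "0 \<le> x t j" for j by (rule nonneg[OF t])
    show "x t j \<le> c + C (t + 1) * (t + 1) powr (1 / (\<beta> + 1))" for j
      using growth[of "t + 1" t j] c[of j] t by simp
  qed
next
  show "continuous_on {t. 0 \<le> t \<and> ereal t < \<infinity>} (\<lambda>t. x t j)" for j
    by (rule continuous_on_subset[OF cont]) auto
next
  show "set_integrable lborel {0..t} (\<lambda>s. x s j powr (- \<beta>) * of_bool (x s j > 0))" if "0 \<le> t" for j t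
    using integrability(2) that by simp
next
  fix j t1 t2 :: real and j' :: int assume t: "0 \<le> t1" "t1 < t2"
  show "set_integrable lborel {t1..t2} (\<lambda>s. Delta_sigma \<beta> (x s) j')"
    using integrability(1) t by simp
next
  fix j :: int and t1 t2 :: real assume t: "0 \<le> t1" "t1 < t2"
  have "(LINT s:{t1..t2}|lborel. Delta_sigma \<beta> (x s) j) = integral {t1..t2} (\<lambda>s. Delta_sigma \<beta> (x s) j)"
    using integrability(1) t by (intro set_borel_integral_eq_integral) simp
  also have "\<dots> = x t2 j - x t1 j"
    unfolding Delta_sigma_eq using eqn[of t1 t2 j] t by (intro integral_unique) simp
  finally show "x t2 j - x t1 j = (LINT s:{t1..t2}|lborel. Delta_sigma \<beta> (x s) j)" ..
qed simp

lemma vanishing_time_exists: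
  obtains \<tau> where "is_vanishing_time \<infinity> x j \<tau>"
    "\<tau> < \<infinity> \<Longrightarrow> \<exists>r\<ge>0. \<tau> = ereal r \<and> x r j = 0 \<and> (\<forall>s. 0 \<le> s \<and> s < r \<longrightarrow> 0 < x s j)"
proof (cases "\<exists>u\<ge>0. x u j = 0")
  case True
  then obtain r where r: "0 \<le> r" "\<And>s. 0 \<le> s \<Longrightarrow> s < r \<Longrightarrow> 0 < x s j" "\<And>s. r \<le> s \<Longrightarrow> x s j = 0"
    using vanishing_time by metis
  have "\<not> (\<forall>t\<ge>0. 0 < x t j)" using r(1) r(3)[of r] by force
  then have "is_vanishing_time \<infinity> x j (ereal r)"
    unfolding is_vanishing_time_def using r by auto
  then show thesis by (rule that) (use r in auto)
next
  case False
  have "0 < x t j" if "0 \<le> t" for t using False nonneg[OF that, of j] that by (metis less_le)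
  then have "is_vanishing_time \<infinity> x j \<infinity>" unfolding is_vanishing_time_def by auto
  then show thesis by (rule that) simp
qed

text \<open>Positivity is known only before \<open>r\<close>, so \<open>lower\<close> is applied at
  times \<open>t + y < r\<close> and \<open>y\<close> is let tend to \<open>r - t\<close>.\<close>

lemma lower_rate:
  assumes T: "0 < T" and r: "r < T" "\<And>s. 0 \<le> s \<Longrightarrow> s < r \<Longrightarrow> 0 < x s j" and t: "0 \<le> t" "t \<le> r"
  shows "K T powr (1 / (\<beta> + 1)) * (r - t) powr (1 / (\<beta> + 1)) \<le> x t j"
proof -
  have K: "0 < K T" using constants_pos[OF T] by simp
  have "r - t \<le> x t j powr (\<beta> + 1) / K T"
  proof (rule dense_le)
    fix y assume y: "y < r - t"
    show "y \<le> x t j powr (\<beta> + 1) / K T"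
    proof (cases "0 \<le> y")
      case True
      then have "K T * (t + y - t) \<le> x t j powr (\<beta> + 1)"
        using y t r by (intro lower[OF T] r(2)) auto
      then show ?thesis using K by (simp add: field_simps)
    next
      case False
      moreover have "0 \<le> x t j powr (\<beta> + 1) / K T" using K by simp
      ultimately show ?thesis by linarith
    qed
  qed
  then have "K T * (r - t) \<le> x t j powr (\<beta> + 1)" using K by (simp add: field_simps)
  then have "(K T * (r - t)) powr (1 / (\<beta> + 1)) \<le> x t j"
    using K t nonneg by (intro powr_le_imp_ge) auto
  then show ?thesis using K t by (simp add: powr_mult)
qed

end

text \<open>The Hoelder norm contains the supremum of the particle size, and \<open>x0 j\<close> may
  be arbitrarily large for given \<beta>, \<open>d\<close> and \<open>L\<close>; therefore the bound
  in (2) contains \<open>x0 j\<close>. Choosing the constants before the data expresses that they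
  depend on the listed parameters only.\<close>

theorem theorem3p9:
  shows "\<exists>(C1 :: real \<Rightarrow> real \<Rightarrow> int \<Rightarrow> real \<Rightarrow> real) (C2 :: real \<Rightarrow> real \<Rightarrow> int \<Rightarrow> real \<Rightarrow> real)
           (C3 :: real \<Rightarrow> real) (K :: real \<Rightarrow> real \<Rightarrow> int \<Rightarrow> real \<Rightarrow> real).
    (\<forall>\<beta>>0. \<forall>d>0. \<forall>L>0. \<forall>T>0. K \<beta> d L T > 0) \<and>
    (\<forall>(\<beta>::real) (x0 :: int \<Rightarrow> real) (d::real) (L::int) (k0::int).
       \<beta> > 0 \<and> x0 \<in> linf_plus \<and> (\<forall>j. x0 j > 0) \<and>
       d > 0 \<and> L > 0 \<and> k0 \<in> {0..L - 1} \<and>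
       (\<forall>k::int. (1 / real_of_int L) * (\<Sum>j = k0 + k * L..k0 + (k + 1) * L - 1. x0 j) \<ge> d)
       \<longrightarrow>
       (\<exists>(x :: real \<Rightarrow> int \<Rightarrow> real) (\<tau> :: int \<Rightarrow> ereal).
          is_solution \<beta> \<infinity> x0 x \<and>
          (\<forall>j. is_vanishing_time \<infinity> x j (\<tau> j)) \<and>
          (\<forall>T>0. \<forall>t\<in>{0..T}. \<forall>j. x t j \<le> x0 j + C1 \<beta> d L T) \<and>
          (\<forall>T>0. \<forall>j. hoelder_continuous_on (1 / (\<beta> + 1)) {0..T} (\<lambda>t. x t j) \<and>
             hoelder_norm (1 / (\<beta> + 1)) T (\<lambda>t. x t j) \<le> ereal (x0 j + C2 \<beta> d L T)) \<and>
          (\<forall>j. \<tau> j < \<infinity> \<longrightarrow>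
             (\<forall>t. 0 \<le> t \<and> ereal t \<le> \<tau> j \<longrightarrow>
                x t j \<le> C3 \<beta> * (real_of_ereal (\<tau> j) - t) powr (1 / (\<beta> + 1)))) \<and>
          (\<forall>T>0. \<forall>j. \<tau> j < ereal T \<longrightarrow>
             (\<forall>t. 0 \<le> t \<and> ereal t \<le> \<tau> j \<longrightarrow>
                x t j \<ge> K \<beta> d L T * (real_of_ereal (\<tau> j) - t) powr (1 / (\<beta> + 1))))))"
proof -
  \<comment> \<open>Density \<open>d / 2\<close> on windows of length \<open>2 * L\<close> is what
    aligned blocks guarantee for every position, so \<open>k0\<close> does not enter the
    constants.\<close>
  have "\<exists>N K C. 0 < \<beta> \<and> 0 < d \<and> 0 < L \<and> 0 < T \<longrightarrow> apriori_constants \<beta> (d / 2) (2 * L) T N K C"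
    for \<beta> d T :: real and L :: int
    using apriori[of \<beta> "d / 2" "2 * L" T] unfolding apriori_constants_def by auto
  then obtain N K C where const: "\<And>\<beta> d L T. 0 < \<beta> \<Longrightarrow> 0 < d \<Longrightarrow> 0 < L \<Longrightarrow> 0 < T \<Longrightarrow>
      apriori_constants \<beta> (d / 2) (2 * L) T (N \<beta> d L T) (K \<beta> d L T) (C \<beta> d L T)"
    by metis
  define C1 where "C1 \<beta> d L T = C \<beta> d L T * T powr (1 / (\<beta> + 1))" for \<beta> d T :: real and L :: int
  define C2 where "C2 \<beta> d L T = C1 \<beta> d L T + C \<beta> d L T" for \<beta> d T :: real and L :: int
  define C3 where "C3 \<beta> = 2 * 4 powr (1 / (\<beta> + 1))" for \<beta> :: real
  define K' where "K' \<beta> d L T = K \<beta> d L T powr (1 / (\<beta> + 1))" for \<beta> d T :: real and L :: int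
  show ?thesis
  proof (rule exI[of _ C1], rule exI[of _ C2], rule exI[of _ C3], rule exI[of _ K'],
      intro conjI allI impI, goal_cases)
    case (1 \<beta> d L T)
    then show ?case using const[of \<beta> d L T] by (simp add: K'_def apriori_constants_def)
  next
    case (2 \<beta> x0 d L k0)
    then have beta: "0 < \<beta>" and x0: "x0 \<in> linf_plus" "\<And>j. 0 < x0 j" and d: "0 < d" and L: "0 < L"
      and blocks: "\<And>k. (1 / real_of_int L) * (\<Sum>j = k0 + k * L..k0 + (k + 1) * L - 1. x0 j) \<ge> d"
      by auto
    have dense: "dense_windows lo hi (2 * L) (d / 2) x0" for lo hi
      by (rule aligned_blocks_dense[OF L x0(2) blocks])
    obtain x where x: "coarsening \<beta> 0 x" "x 0 = x0"
      using coarsening_exists[of \<beta> "d / 2" "2 * L" x0] beta d L x0(2) dense by auto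
    interpret coarsening \<beta> 0 x by fact
    interpret dense_coarsening \<beta> x "d / 2" "2 * L" "N \<beta> d L" "K \<beta> d L" "C \<beta> d L"
      by unfold_locales (use d x(2) x0(1) dense const[OF beta d L] in auto)
    have "\<forall>j. \<exists>\<tau>. is_vanishing_time \<infinity> x j \<tau> \<and> (\<tau> < \<infinity> \<longrightarrow>
        (\<exists>r\<ge>0. \<tau> = ereal r \<and> x r j = 0 \<and> (\<forall>s. 0 \<le> s \<and> s < r \<longrightarrow> 0 < x s j)))"
      using vanishing_time_exists by metis
    then obtain \<tau> where \<tau>: "\<And>j. is_vanishing_time \<infinity> x j (\<tau> j)"
      and fin: "\<And>j. \<tau> j < \<infinity> \<Longrightarrow>
        \<exists>r\<ge>0. \<tau> j = ereal r \<and> x r j = 0 \<and> (\<forall>s. 0 \<le> s \<and> s < r \<longrightarrow> 0 < x s j)"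
      by metis
    show ?case
    proof (rule exI[of _ x], rule exI[of _ \<tau>], intro conjI allI impI ballI; (elim conjE)?)
      show "is_solution \<beta> \<infinity> x0 x" using solution x(2) by simp
      show "is_vanishing_time \<infinity> x j (\<tau> j)" for j by (rule \<tau>)
      show "x t j \<le> x0 j + C1 \<beta> d L T" if "0 < T" "t \<in> {0..T}" for T t j
        using growth[of T t j] that x(2) by (simp add: C1_def)
      show "hoelder_continuous_on (1 / (\<beta> + 1)) {0..T} (\<lambda>t. x t j)" if "0 < T" for T j
        using hoelder[OF that] by (intro hoelder_continuous_onI)
      show "hoelder_norm (1 / (\<beta> + 1)) T (\<lambda>t. x t j) \<le> ereal (x0 j + C2 \<beta> d L T)" if T: "0 < T" for T j
      proof -
        have "hoelder_norm (1 / (\<beta> + 1)) T (\<lambda>t. x t j) \<le> ereal ((x 0 j + C1 \<beta> d L T) + C \<beta> d L T)"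
          using growth[OF T] nonneg by (intro hoelder_norm_le[OF T] hoelder[OF T]) (auto simp: C1_def)
        then show ?thesis using x(2) by (simp add: C2_def add.assoc)
      qed
      show "x t j \<le> C3 \<beta> * (real_of_ereal (\<tau> j) - t) powr (1 / (\<beta> + 1))"
        if "\<tau> j < \<infinity>" "0 \<le> t" "ereal t \<le> \<tau> j" for j t
        using fin[OF that(1)] that upper_rate[of t _ j] by (auto simp: C3_def)
      show "K' \<beta> d L T * (real_of_ereal (\<tau> j) - t) powr (1 / (\<beta> + 1)) \<le> x t j"
        if T: "0 < T" and \<tau>T: "\<tau> j < ereal T" and t: "0 \<le> t" "ereal t \<le> \<tau> j" for T j t
      proof -
        have "\<tau> j < \<infinity>" using less_trans[OF \<tau>T, of \<infinity>] by simp
        then obtain r where r: "\<tau> j = ereal r" "\<And>s. 0 \<le> s \<Longrightarrow> s < r \<Longrightarrow> 0 < x s j" using fin by blast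
        show ?thesis using lower_rate[OF T _ r(2) t(1)] \<tau>T t r(1) by (simp add: K'_def)
      qed
    qed
  qed
qed

end
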